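(* For all integers $n \geq 0$ and $k \geq 0$, $$\overline{R_6^*}\left(18\cdot 3^{2k+1}n+\frac{153\cdot 3^{2k}-1}{4}\right)\equiv 0 \pmod{128}.$$
   Context: An overpartition of a nonnegative integer $n$ is a partition of $n$ (a finite non-increasing sequence of positive integers summing to $n$) in which the first occurrence of each distinct part may optionally be overlined. For a positive integer $\ell$, $\overline{R_\ell^*}(n)$ denotes the number of overpartitions of $n$ in which no non-overlined part is divisible by $\ell$ (overlined parts are unrestricted); $\overline{R_\ell^*}(0)=1$. Equivalently, $\sum_{n\ge 0}\overline{R_\ell^*}(n)q^n = \frac{f_2 f_\ell}{f_1^2}$, where $f_k=\prod_{m\ge 1}(1-q^{km})$. Here $\ell=6$. *)

theory Defs
  imports Main "HOL-Library.Multiset"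
begin

text \<open>An overpartition of n is encoded by the multiset M of its parts (all positive,
summing to n) together with the set B of part sizes whose first occurrence is
overlined (O is a subset of the distinct parts). The overlined occurrences are
exactly one occurrence of each size in B; all other occurrences are non-overlined.
No non-overlined part is divisible by l means: every part x with l dvd x is
overlined and occurs only once (its single occurrence being the overlined one).\<close>

definition overpartitions_R :: "nat \<Rightarrow> nat \<Rightarrow> (nat multiset \<times> nat set) set" where
  "overpartitions_R l n = {(M, B).
      (\<forall>x \<in># M. 0 < x) \<and> sum_mset M = n \<and> B \<subseteq> set_mset M \<and>
      (\<forall>x \<in># M. l dvd x \<longrightarrow> x \<in> B \<and> count M x = 1)}"

definition Rbar_star :: "nat \<Rightarrow> nat \<Rightarrow> nat" where
  "Rbar_star l n = card (overpartitions_R l n)"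

end

theory Submission
  imports Defs "HOL-Computational_Algebra.Formal_Power_Series" "HOL-Library.Z2"
begin

text \<open>Write \<open>f\<^sub>d\<close> for the product of the \<open>1 - q\<^bsup>dm\<^esup>\<close>, \<open>\<phi>\<close> for \<open>f\<^sub>1\<^sup>2 / f\<^sub>2\<close>, that is the sum of
  \<open>(-1)\<^sup>n q\<^bsup>n * n\<^esup>\<close> over all integers, and \<open>F\<close> for the generating function \<open>f\<^sub>6 / \<phi>\<close>. Multiplying
  numerator and denominator by the conjugates of \<open>\<phi>\<close> under \<open>q \<mapsto> \<zeta> q\<close> with \<open>\<zeta>\<^sup>3 = 1\<close> gives the part
  of \<open>F\<close> with exponents congruent to 2 modulo 3: it is \<open>4 q\<^sup>2 f\<^sub>1\<^sub>8\<^sup>3 / \<phi>(q\<^sup>3)\<^sup>3\<close>. So it remains to work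
  modulo 32.

  With \<open>\<phi>(q\<^sup>3) = 1 + 2 S\<close> the inverse cube is \<open>1 - 6 S - 8 S\<^sup>2 + 16 S\<^sup>3 + 16 S\<^sup>4\<close> modulo 32, and Jacobi's
  series for \<open>f\<^sub>1\<^sub>8\<^sup>3\<close> is supported on odd squares. If \<open>4 N + 1 = 9 M\<close> with \<open>M = 9\<^sup>k (24 n + 17)\<close>, the
  coefficients at \<open>N\<close> belonging to the powers 0, 1, 2, 4 of \<open>S\<close> vanish (the last one modulo 2),
  because \<open>3 t\<^sup>2 + 4 a\<^sup>2 + 4 b\<^sup>2 = 3 M\<close> is unsolvable by descent at 3. The coefficient of \<open>S\<^sup>3\<close> is
  modulo 2 the number of positive solutions of \<open>3 t\<^sup>2 + 4 a\<^sup>2 + 8 b\<^sup>2 = 3 M\<close>. Arithmetic at 3 in the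
  integers with \<open>sqrt (-2)\<close> adjoined reduces its parity to \<open>t\<^sup>2 + 4 a\<^sup>2 + 8 b\<^sup>2 = M\<close>, and there it comes
  down to an identity between theta series over the field with two elements.\<close>

section \<open>Truncated equality of power series\<close>
text \<open>Congruence modulo \<open>fps_X ^ K\<close>. Infinite products are handled through their
  partial products and \<open>fps_eqI_agree\<close>, without a topology on power series.\<close>

definition fps_agree :: "nat \<Rightarrow> 'a fps \<Rightarrow> 'a fps \<Rightarrow> bool" where
  "fps_agree K f g \<longleftrightarrow> (\<forall>i<K. fps_nth f i = fps_nth g i)"

lemma fps_agree_refl [simp]: "fps_agree K f f"
  by (simp add: fps_agree_def)

lemma fps_agree_sym: "fps_agree K f g \<Longrightarrow> fps_agree K g f"
  by (simp add: fps_agree_def)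

lemma fps_agree_trans [trans]: "fps_agree K f g \<Longrightarrow> fps_agree K g h \<Longrightarrow> fps_agree K f h"
  by (simp add: fps_agree_def)

lemma fps_agree_mono: "fps_agree K f g \<Longrightarrow> L \<le> K \<Longrightarrow> fps_agree L f g"
  by (auto simp: fps_agree_def)

lemma fps_agree_mult:
  fixes f g f' g' :: "'a::comm_semiring_1 fps"
  shows "fps_agree K f g \<Longrightarrow> fps_agree K f' g' \<Longrightarrow> fps_agree K (f * f') (g * g')"
  by (auto simp: fps_agree_def fps_mult_nth intro!: sum.cong)

lemma fps_agree_power:
  fixes f g :: "'a::comm_semiring_1 fps"
  shows "fps_agree K f g \<Longrightarrow> fps_agree K (f ^ n) (g ^ n)"
  by (induction n) (auto intro: fps_agree_mult)

lemma fps_agree_add: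
  fixes f g f' g' :: "'a::comm_semiring_1 fps"
  shows "fps_agree K f g \<Longrightarrow> fps_agree K f' g' \<Longrightarrow> fps_agree K (f + f') (g + g')"
  by (auto simp: fps_agree_def)

lemma fps_agree_diff:
  fixes f g f' g' :: "'a::comm_ring_1 fps"
  shows "fps_agree K f g \<Longrightarrow> fps_agree K f' g' \<Longrightarrow> fps_agree K (f - f') (g - g')"
  by (auto simp: fps_agree_def)

lemma fps_agree_sum:
  fixes f g :: "'b \<Rightarrow> 'a::comm_semiring_1 fps"
  shows "(\<And>x. x \<in> A \<Longrightarrow> fps_agree K (f x) (g x)) \<Longrightarrow> fps_agree K (sum f A) (sum g A)"
  by (induction A rule: infinite_finite_induct) (auto intro: fps_agree_add)

text \<open>Orders of vanishing add up: if \<open>i < K\<close> fails, the complementary index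
  \<open>n - i\<close> is below \<open>L\<close>.\<close>

lemma fps_agree_0_mult:
  fixes f g :: "'a::comm_semiring_1 fps"
  assumes "fps_agree K f 0" "fps_agree L g 0"
  shows "fps_agree (K + L) (f * g) 0"
proof -
  have "fps_nth f i * fps_nth g (n - i) = 0" if "n < K + L" "i \<le> n" for n i
  proof (cases "i < K")
    case True
    then show ?thesis using assms by (simp add: fps_agree_def)
  next
    case False
    then have "n - i < L" using that by linarith
    then show ?thesis using assms by (simp add: fps_agree_def)
  qed
  then show ?thesis by (auto simp: fps_agree_def fps_mult_nth intro!: sum.neutral)
qed

lemma fps_agree_X_power: "fps_agree K (fps_X ^ m :: 'a::comm_semiring_1 fps) 0" if "K \<le> m"
  using that by (auto simp: fps_agree_def)

lemma fps_eqI_agree: "(\<And>K. fps_agree K f g) \<Longrightarrow> f = g"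
  by (rule fps_ext) (auto simp: fps_agree_def)

text \<open>A constant coefficient 1 makes the linear system for the coefficients unitriangular, so
  they are determined one after another.\<close>

lemma fps_agree_cancel_left:
  fixes u f g :: "'a::comm_ring_1 fps"
  assumes "fps_nth u 0 = 1" "fps_agree K (u * f) (u * g)"
  shows "fps_agree K f g"
proof -
  have "fps_nth f i = fps_nth g i" if "i < K" for i
    using that
  proof (induction i rule: less_induct)
    case (less i)
    have expand: "fps_nth (u * h) i = fps_nth h i + (\<Sum>j\<in>{1..i}. fps_nth u j * fps_nth h (i - j))" for h
      using assms(1) by (simp add: fps_mult_nth sum.atLeast_Suc_atMost)
    have "(\<Sum>j\<in>{1..i}. fps_nth u j * fps_nth f (i - j)) = (\<Sum>j\<in>{1..i}. fps_nth u j * fps_nth g (i - j))"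
      using less by (intro sum.cong) auto
    moreover have "fps_nth (u * f) i = fps_nth (u * g) i"
      using assms(2) less.prems by (simp add: fps_agree_def)
    ultimately show ?case using expand[of f] expand[of g] by simp
  qed
  then show ?thesis by (simp add: fps_agree_def)
qed

section \<open>Theta-like series\<close>

text \<open>The formal sum of the monomials \<open>w i * fps_X ^ e i\<close>. Over an infinite fibre
  of \<open>e\<close> the coefficient would be 0, the default value of \<open>sum\<close>; hence the
  product and union rules assume \<open>finite_fibres\<close>.\<close>

definition theta_ser :: "('i \<Rightarrow> nat) \<Rightarrow> 'i set \<Rightarrow> ('i \<Rightarrow> 'a::comm_monoid_add) \<Rightarrow> 'a fps" where
  "theta_ser e I w = Abs_fps (\<lambda>n. \<Sum>i\<in>{i\<in>I. e i = n}. w i)"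

definition finite_fibres :: "('i \<Rightarrow> nat) \<Rightarrow> 'i set \<Rightarrow> bool" where
  "finite_fibres e I \<longleftrightarrow> (\<forall>n. finite {i\<in>I. e i = n})"

lemma theta_ser_nth: "fps_nth (theta_ser e I w) n = (\<Sum>i\<in>{i\<in>I. e i = n}. w i)"
  by (simp add: theta_ser_def)

lemma theta_ser_nth_eq_0: "(\<And>i. i \<in> I \<Longrightarrow> e i \<noteq> n) \<Longrightarrow> fps_nth (theta_ser e I w) n = 0"
  by (auto simp: theta_ser_nth intro!: sum.neutral)

lemma theta_ser_nth_one:
  "fps_nth (theta_ser e I (\<lambda>_. 1 :: 'a::semiring_1)) n = of_nat (card {i\<in>I. e i = n})"
  by (simp add: theta_ser_nth)

lemma finite_fibresI_le:
  assumes "\<And>n. finite {i\<in>I. g i \<le> n}" "\<And>i. i \<in> I \<Longrightarrow> (g i :: nat) \<le> e i + c"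
  shows "finite_fibres e I"
  unfolding finite_fibres_def
proof
  fix n
  have "{i\<in>I. e i = n} \<subseteq> {i\<in>I. g i \<le> n + c}" using assms(2) by auto
  then show "finite {i\<in>I. e i = n}" using assms(1) finite_subset by blast
qed

lemma finite_fibres_int:
  "(\<And>i. i \<in> I \<Longrightarrow> nat \<bar>i\<bar> \<le> e i + c) \<Longrightarrow> finite_fibres e (I :: int set)"
proof (rule finite_fibresI_le[where g = "\<lambda>i. nat \<bar>i\<bar>"])
  fix n
  have "{i \<in> I. nat \<bar>i\<bar> \<le> n} \<subseteq> {- int n..int n}" by auto
  then show "finite {i \<in> I. nat \<bar>i\<bar> \<le> n}" using finite_subset by blast
qed auto

lemma finite_fibres_subset: "finite_fibres e I \<Longrightarrow> J \<subseteq> I \<Longrightarrow> finite_fibres e J"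
  unfolding finite_fibres_def by (auto intro: rev_finite_subset)

lemma finite_fibres_prod:
  assumes "finite_fibres e I" "finite_fibres e' J"
  shows "finite_fibres (\<lambda>(i, j). e i + e' j) (I \<times> J)"
  unfolding finite_fibres_def
proof
  fix n
  have "{p \<in> I \<times> J. (case p of (i, j) \<Rightarrow> e i + e' j) = n}
      \<subseteq> (\<Union>k\<le>n. {i\<in>I. e i = k} \<times> {j\<in>J. e' j = n - k})" by auto
  moreover have "finite \<dots>" using assms by (auto simp: finite_fibres_def)
  ultimately show "finite {p \<in> I \<times> J. (case p of (i, j) \<Rightarrow> e i + e' j) = n}"
    by (rule finite_subset)
qed

lemma theta_ser_mult:
  fixes w :: "'i \<Rightarrow> 'a::comm_semiring_1"
  assumes "finite_fibres e I" "finite_fibres e' J"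
  shows "theta_ser e I w * theta_ser e' J w'
    = theta_ser (\<lambda>(i, j). e i + e' j) (I \<times> J) (\<lambda>(i, j). w i * w' j)"
proof (rule fps_ext)
  fix n
  let ?A = "\<lambda>k. {i\<in>I. e i = k}" and ?B = "\<lambda>k. {j\<in>J. e' j = k}"
  have "fps_nth (theta_ser e I w * theta_ser e' J w') n
      = (\<Sum>k\<le>n. \<Sum>p\<in>?A k \<times> ?B (n - k). case p of (i, j) \<Rightarrow> w i * w' j)"
    by (simp add: fps_mult_nth theta_ser_nth sum_product sum.cartesian_product atLeast0AtMost)
  also have "\<dots> = (\<Sum>p\<in>(\<Union>k\<le>n. ?A k \<times> ?B (n - k)). case p of (i, j) \<Rightarrow> w i * w' j)"
    using assms by (intro sum.UNION_disjoint[symmetric]) (auto simp: finite_fibres_def)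
  also have "(\<Union>k\<le>n. ?A k \<times> ?B (n - k)) = {p \<in> I \<times> J. (case p of (i, j) \<Rightarrow> e i + e' j) = n}"
    by auto
  finally show "fps_nth (theta_ser e I w * theta_ser e' J w') n
    = fps_nth (theta_ser (\<lambda>(i, j). e i + e' j) (I \<times> J) (\<lambda>(i, j). w i * w' j)) n"
    by (simp add: theta_ser_nth)
qed

lemma theta_ser_reindex:
  assumes "bij_betw h I J" "\<And>i. i \<in> I \<Longrightarrow> e' (h i) = e i" "\<And>i. i \<in> I \<Longrightarrow> w' (h i) = w i"
  shows "theta_ser e I w = theta_ser e' J w'"
proof (rule fps_ext)
  fix n
  have "bij_betw h {i\<in>I. e i = n} {j\<in>J. e' j = n}"
    using assms(1,2) unfolding bij_betw_def inj_on_def by (auto simp: image_iff)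
  then show "fps_nth (theta_ser e I w) n = fps_nth (theta_ser e' J w') n"
    unfolding theta_ser_nth by (subst sum.reindex_bij_betw[symmetric]) (auto simp: assms(3) intro!: sum.cong)
qed

lemma theta_ser_Un:
  assumes "finite_fibres e I" "finite_fibres e J" "I \<inter> J = {}"
  shows "theta_ser e (I \<union> J) w = theta_ser e I w + theta_ser e J w"
proof (rule fps_ext)
  fix n
  have "{i \<in> I \<union> J. e i = n} = {i\<in>I. e i = n} \<union> {i\<in>J. e i = n}" by auto
  then show "fps_nth (theta_ser e (I \<union> J) w) n = fps_nth (theta_ser e I w + theta_ser e J w) n"
    using assms by (simp add: theta_ser_nth finite_fibres_def sum.union_disjoint disjoint_iff)
qed

lemma theta_ser_cmult:
  "theta_ser e I (\<lambda>i. c * w i) = fps_const (c::'a::comm_semiring_1) * theta_ser e I w"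
  by (rule fps_ext) (simp add: theta_ser_nth sum_distrib_left)

lemma theta_ser_shift:
  "fps_X ^ m * theta_ser e I w = theta_ser (\<lambda>i. e i + m) I (w :: _ \<Rightarrow> 'a::comm_semiring_1)"
proof (rule fps_ext)
  fix n
  have "{i \<in> I. e i + m = n} = (if n < m then {} else {i\<in>I. e i = n - m})" by auto
  then show "fps_nth (fps_X ^ m * theta_ser e I w) n = fps_nth (theta_ser (\<lambda>i. e i + m) I w) n"
    by (simp add: fps_X_power_mult_nth theta_ser_nth)
qed

text \<open>The indices \<open>n\<close> and \<open>- n\<close> contribute equally. This factor 2 is
  the source of the expansions \<open>1 + 2 * S\<close> behind the reductions modulo powers of
  2.\<close>

lemma theta_ser_even:
  fixes e :: "int \<Rightarrow> nat" and w :: "int \<Rightarrow> 'a::comm_semiring_1"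
  assumes "finite_fibres e UNIV" "\<And>n. e (- n) = e n" "\<And>n. w (- n) = w n"
  shows "theta_ser e UNIV w = fps_const (w 0) * fps_X ^ e 0 + 2 * theta_ser e {0<..} w"
proof -
  have ff: "finite_fibres e I" for I using assms(1) by (rule finite_fibres_subset) simp
  have "(UNIV :: int set) = {0} \<union> ({0<..} \<union> {..<0})" by auto
  then have "theta_ser e UNIV w = theta_ser e ({0} \<union> ({0<..} \<union> {..<0})) w" by simp
  also have "\<dots> = theta_ser e {0} w + (theta_ser e {0<..} w + theta_ser e {..<0} w)"
    by (subst theta_ser_Un[OF ff ff], force, subst theta_ser_Un[OF ff ff], auto)
  also have "theta_ser e {0} w = fps_const (w 0) * fps_X ^ e 0"
  proof (rule fps_ext)
    fix n
    have "{i \<in> {0}. e i = n} = (if n = e 0 then {0} else {})" by auto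
    then show "fps_nth (theta_ser e {0} w) n = fps_nth (fps_const (w 0) * fps_X ^ e 0) n"
      by (simp add: theta_ser_nth)
  qed
  also have "theta_ser e {..<0} w = theta_ser e {0<..} w"
  proof (rule theta_ser_reindex)
    show "bij_betw uminus {..<0::int} {0<..}"
      by (rule bij_betwI[where g = uminus]) auto
  qed (simp_all add: assms)
  finally show ?thesis unfolding mult_2 .
qed

section \<open>The Jacobi triple product\<close>

definition qpoch :: "'a::comm_ring_1 \<Rightarrow> nat \<Rightarrow> 'a" where
  "qpoch q n = (\<Prod>m=1..n. 1 - q ^ m)"

lemma qpoch_0 [simp]: "qpoch q 0 = 1"
  and qpoch_Suc [simp]: "qpoch q (Suc n) = (1 - q ^ Suc n) * qpoch q n"
  by (simp_all add: qpoch_def mult.commute)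

text \<open>The Gaussian binomial coefficient, defined by a Pascal rule since a general commutative
  ring has no quotients; \<open>qbinom_qpoch\<close> is the division-free form of the quotient
  formula.\<close>

fun qbinom :: "'a::comm_ring_1 \<Rightarrow> nat \<Rightarrow> nat \<Rightarrow> 'a" where
  "qbinom q n 0 = 1"
| "qbinom q 0 (Suc k) = 0"
| "qbinom q (Suc n) (Suc k) = qbinom q n k + q ^ Suc k * qbinom q n (Suc k)"

lemma qbinom_eq_0: "n < k \<Longrightarrow> qbinom q n k = 0"
  by (induction q n k rule: qbinom.induct) auto

text \<open>The mirror image of the defining Pascal rule, with the power of \<open>q\<close> on the
  other summand. The finite triple product needs both rules, one for each of its two
  products.\<close>

lemma qbinom_Suc_Suc':
  "k \<le> n \<Longrightarrow> qbinom q (Suc n) (Suc k) = q ^ (n - k) * qbinom q n k + qbinom q n (Suc k)"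
proof (induction n arbitrary: k)
  case 0
  then show ?case by simp
next
  case (Suc n)
  show ?case
  proof (cases k)
    case 0
    have "qbinom q (Suc n) (Suc 0) = q ^ n + qbinom q n (Suc 0)"
      using Suc.IH[of 0] by (simp del: qbinom.simps(3))
    then show ?thesis using 0 by (simp add: algebra_simps)
  next
    case (Suc l)
    then have l: "l \<le> n" using Suc.prems by simp
    have 1: "q ^ Suc k * qbinom q (Suc n) (Suc k)
        = q ^ Suc n * qbinom q n k + q ^ Suc k * qbinom q n (Suc k)"
    proof (cases "k \<le> n")
      case True
      then show ?thesis
        by (simp add: Suc.IH distrib_left mult.assoc[symmetric] power_add[symmetric] 
            del: qbinom.simps(3) power_Suc)
    qed (simp add: qbinom_eq_0)
    have "q ^ (n - l) * (q ^ k * qbinom q n k) = q ^ Suc n * qbinom q n k"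
      using l Suc by (simp add: mult.assoc[symmetric] power_add[symmetric] del: power_Suc)
    then have "q ^ (Suc n - k) * qbinom q (Suc n) k + qbinom q (Suc n) (Suc k)
        = q ^ (n - l) * qbinom q n l + q ^ Suc n * qbinom q n k + qbinom q (Suc n) (Suc k)"
      using Suc by (simp add: algebra_simps)
    also have "\<dots> = q ^ (n - l) * qbinom q n l + qbinom q n k
        + (q ^ Suc n * qbinom q n k + q ^ Suc k * qbinom q n (Suc k))"
      by (simp add: algebra_simps)
    also have "\<dots> = qbinom q (Suc n) k + q ^ Suc k * qbinom q (Suc n) (Suc k)"
      using Suc.IH[OF l] Suc 1 by (simp del: qbinom.simps(3))
    finally show ?thesis by simp
  qed
qed

lemma qbinom_qpoch: "qpoch q k * qpoch q m * qbinom q (k + m) k = qpoch q (k + m)"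
proof (induction "k + m" arbitrary: k m rule: less_induct)
  case less
  show ?case
  proof (cases k)
    case (Suc k')
    note k = this
    show ?thesis
    proof (cases m)
      case 0
      have "qbinom q (Suc n) (Suc n) = 1" for n
        by (induction n) (simp_all add: qbinom_eq_0)
      then show ?thesis using 0 k by (simp del: qbinom.simps(3))
    next
      case (Suc m')
      have 1: "qpoch q k' * qpoch q m * qbinom q (k' + m) k' = qpoch q (k' + m)"
        using less[of k' m] k by simp
      have 2: "qpoch q k * qpoch q m' * qbinom q (k + m') k = qpoch q (k + m')"
        using less[of k m'] Suc by simp
      have eq: "k + m = Suc (k' + m)" "k' + m = k + m'" using k Suc by simp_all
      have "qbinom q (k + m) k = qbinom q (k' + m) k' + q ^ k * qbinom q (k + m') k"
        unfolding eq(1) eq(2)[symmetric] using k by simp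
      moreover have "qpoch q k = (1 - q ^ k) * qpoch q k'" "qpoch q m = (1 - q ^ m) * qpoch q m'"
        using k Suc by simp_all
      ultimately have "qpoch q k * qpoch q m * qbinom q (k + m) k
          = (1 - q ^ k) * (qpoch q k' * qpoch q m * qbinom q (k' + m) k')
            + q ^ k * ((1 - q ^ m) * (qpoch q k * qpoch q m' * qbinom q (k + m') k))"
        by (simp only:) (simp only: algebra_simps)
      also have "\<dots> = (1 - q ^ (k + m)) * qpoch q (k' + m)"
        unfolding 1 2 using eq(2) by (simp add: algebra_simps power_add)
      finally show ?thesis using eq(1) by (simp only: qpoch_Suc)
    qed
  qed simp
qed

text \<open>With \<open>q = z y\<close> this is \<open>(-1)\<^sup>n z\<^sup>n q\<^bsup>n (n - 1) / 2\<^esup>\<close>, written without inverse powers of \<open>z\<close>.\<close>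
definition jacobi_term :: "'a::comm_ring_1 \<Rightarrow> 'a \<Rightarrow> int \<Rightarrow> 'a" where
  "jacobi_term z y n = (if n \<ge> 0 then (-1) ^ nat n * z ^ nat n * (z * y) ^ (nat n choose 2)
     else (-1) ^ nat (-n) * y ^ nat (-n) * (z * y) ^ (nat (-n) choose 2))"

lemma jacobi_term_minus: "jacobi_term z y (-n) = jacobi_term y z n"
  by (auto simp: jacobi_term_def mult.commute)

lemma choose_2_Suc: "Suc n choose 2 = n + (n choose 2)"
  by (simp add: numeral_2_eq_2)

text \<open>Formally the next term is the present one times \<open>- z * q ^ n\<close> with
  \<open>q = z * y\<close>; the extra factor \<open>q ^ (i - n)\<close> keeps all exponents
  nonnegative, also for negative \<open>n\<close>.\<close>

lemma jacobi_term_step: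
  assumes "n \<le> int i"
  shows "z * (z * y) ^ i * jacobi_term z y n = - ((z * y) ^ nat (int i - n) * jacobi_term z y (n + 1))"
proof (cases "n \<ge> 0")
  case True
  then obtain m where m: "n = int m" by (metis nonneg_int_cases)
  then have "nat (int i - n) + (Suc m choose 2) = i + (m choose 2)"
    using assms by (simp add: choose_2_Suc)
  then have "(z * y) ^ nat (int i - n) * (z * y) ^ (Suc m choose 2) = (z * y) ^ i * (z * y) ^ (m choose 2)"
    by (simp add: power_add[symmetric])
  moreover have "nat (1 + int m) = Suc m" "nat (int m + 1) = Suc m" by simp_all
  ultimately show ?thesis using m by (simp add: jacobi_term_def algebra_simps)
next
  case False
  then obtain m where m: "n = - int (Suc m)"
    by (metis int_cases linorder_not_le negative_zle_0 of_nat_0_le_iff)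
  have e: "nat (int i - n) = Suc (i + m)" "nat (- n) = Suc m" "nat (-(n + 1)) = m" using m by simp_all
  have "jacobi_term z y (n + 1) = (-1) ^ m * y ^ m * (z * y) ^ (m choose 2)"
    using m e(3) by (cases "m = 0") (simp_all add: jacobi_term_def binomial_eq_0)
  moreover have "jacobi_term z y n = (-1) ^ Suc m * y ^ Suc m * (z * y) ^ (m + (m choose 2))"
    using False e by (simp add: jacobi_term_def choose_2_Suc del: power_Suc)
  ultimately show ?thesis
    unfolding e(1) by (simp add: power_add mult_ac)
qed

text \<open>Induction on \<open>j\<close>, with an inner induction on \<open>i\<close> for
  \<open>j = 0\<close>. A new factor in \<open>z\<close> is absorbed by
  \<open>qbinom_Suc_Suc'\<close>, one in \<open>y\<close> by the defining Pascal rule;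
  \<open>jacobi_term_step\<close> shifts the summation index in both cases.\<close>

lemma finite_jacobi_triple:
  fixes z y :: "'a::comm_ring_1"
  defines "q \<equiv> z * y"
  shows "(\<Prod>k<i. 1 - z * q ^ k) * (\<Prod>k<j. 1 - y * q ^ k)
    = (\<Sum>k\<le>i + j. qbinom q (i + j) k * jacobi_term z y (int k - int j))"
proof (induction j)
  case 0
  show ?case
  proof (induction i)
    case 0
    then show ?case by (simp add: jacobi_term_def binomial_eq_0)
  next
    case (Suc i)
    let ?t = "jacobi_term z y"
    let ?S = "\<Sum>k\<le>i. qbinom q i k * ?t (int k)"
    have "z * q ^ i * ?S = (\<Sum>k\<le>i. - (q ^ (i - k) * qbinom q i k * ?t (int (Suc k))))"
      unfolding sum_distrib_left
    proof (rule sum.cong[OF refl])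
      fix k assume "k \<in> {..i}"
      then have "z * q ^ i * ?t (int k) = - (q ^ (i - k) * ?t (int k + 1))"
        using jacobi_term_step[of "int k" i z y] by (simp add: q_def nat_diff_distrib)
      then show "z * q ^ i * (qbinom q i k * ?t (int k)) = - (q ^ (i - k) * qbinom q i k * ?t (int (Suc k)))"
        by (simp add: algebra_simps)
    qed
    moreover have "?S = ?t 0 + (\<Sum>k\<le>i. qbinom q i (Suc k) * ?t (int (Suc k)))"
      using sum.atMost_Suc_shift[of "\<lambda>k. qbinom q i k * ?t (int k)" i] by (simp add: qbinom_eq_0)
    ultimately have "?S - z * q ^ i * ?S
        = ?t 0 + (\<Sum>k\<le>i. qbinom q i (Suc k) * ?t (int (Suc k)))
          + (\<Sum>k\<le>i. q ^ (i - k) * qbinom q i k * ?t (int (Suc k)))"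
      by (simp only: sum_negf diff_minus_eq_add)
    also have "\<dots> = ?t 0 + (\<Sum>k\<le>i. qbinom q (Suc i) (Suc k) * ?t (int (Suc k)))"
      unfolding add.assoc sum.distrib[symmetric]
      by (intro arg_cong2[where f = "(+)"] sum.cong refl)
        (simp_all add: qbinom_Suc_Suc' algebra_simps del: qbinom.simps(3))
    also have "\<dots> = (\<Sum>k\<le>Suc i. qbinom q (Suc i) k * ?t (int k))"
      using sum.atMost_Suc_shift[of "\<lambda>k. qbinom q (Suc i) k * ?t (int k)" i] by (simp del: qbinom.simps(3))
    finally have step: "?S - z * q ^ i * ?S = (\<Sum>k\<le>Suc i. qbinom q (Suc i) k * ?t (int k))" .
    have "(\<Prod>k<i. 1 - z * q ^ k) = ?S" using Suc.IH by simp
    then have "(\<Prod>k<Suc i. 1 - z * q ^ k) = ?S - z * q ^ i * ?S"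
      by (simp add: left_diff_distrib mult.commute)
    then show ?case unfolding step by (simp del: qbinom.simps(3))
  qed
next
  case (Suc j)
  let ?t = "jacobi_term z y"
  let ?N = "i + j"
  let ?S = "\<Sum>k\<le>?N. qbinom q ?N k * ?t (int k - int j)"
  have "y * q ^ j * ?S = (\<Sum>k\<le>?N. - (q ^ k * qbinom q ?N k * ?t (int k - int (Suc j))))"
    unfolding sum_distrib_left
  proof (rule sum.cong[OF refl])
    fix k
    have "y * q ^ j * ?t (int k - int j) = - (q ^ k * ?t (int k - int (Suc j)))"
    proof -
      have "- (int j - int k) = int k - int j" "- (int j - int k + 1) = int k - int (Suc j)"
        "nat (int j - (int j - int k)) = k" "y * z = q"
        by (simp_all add: q_def mult.commute)
      then show ?thesis
        using jacobi_term_step[of "int j - int k" j y z] jacobi_term_minus[of z y "int j - int k"]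
          jacobi_term_minus[of z y "int j - int k + 1"] by (simp add: diff_diff_eq add.commute)
    qed
    moreover have "y * q ^ j * (qbinom q ?N k * ?t (int k - int j))
        = qbinom q ?N k * (y * q ^ j * ?t (int k - int j))"
      by (simp only: mult_ac)
    ultimately show "y * q ^ j * (qbinom q ?N k * ?t (int k - int j))
        = - (q ^ k * qbinom q ?N k * ?t (int k - int (Suc j)))"
      by (simp only: mult_minus_right mult_ac)
  qed
  moreover have "(\<Sum>k\<le>?N. q ^ k * qbinom q ?N k * ?t (int k - int (Suc j)))
      = ?t (- int (Suc j)) + (\<Sum>k\<le>?N. q ^ Suc k * qbinom q ?N (Suc k) * ?t (int k - int j))"
    using sum.atMost_Suc_shift[of "\<lambda>k. q ^ k * qbinom q ?N k * ?t (int k - int (Suc j))" ?N]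
    by (simp add: qbinom_eq_0)
  ultimately have "?S - y * q ^ j * ?S = ?S + (?t (- int (Suc j))
      + (\<Sum>k\<le>?N. q ^ Suc k * qbinom q ?N (Suc k) * ?t (int k - int j)))"
    by (simp only: sum_negf diff_minus_eq_add)
  also have "\<dots> = ?t (- int (Suc j)) + (\<Sum>k\<le>?N. qbinom q (Suc ?N) (Suc k) * ?t (int k - int j))"
    unfolding add.left_commute[of ?S] sum.distrib[symmetric]
    by (intro arg_cong2[where f = "(+)"] sum.cong refl) (simp_all add: distrib_right)
  also have "\<dots> = (\<Sum>k\<le>Suc ?N. qbinom q (Suc ?N) k * ?t (int k - int (Suc j)))"
    using sum.atMost_Suc_shift[of "\<lambda>k. qbinom q (Suc ?N) k * ?t (int k - int (Suc j))" ?N]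
    by (simp del: qbinom.simps(3))
  finally have step: "?S - y * q ^ j * ?S
    = (\<Sum>k\<le>Suc ?N. qbinom q (Suc ?N) k * ?t (int k - int (Suc j)))" .
  have "(\<Prod>k<i. 1 - z * q ^ k) * (\<Prod>k<Suc j. 1 - y * q ^ k) = ?S * (1 - y * q ^ j)"
    unfolding Suc.IH[symmetric] by (simp add: mult_ac)
  also have "\<dots> = ?S - y * q ^ j * ?S" unfolding mult.commute[of ?S] by (simp only: left_diff_distrib mult_1_left)
  finally show ?case unfolding step add_Suc_right .
qed

section \<open>Euler products\<close>

text \<open>The product \<open>f\<^sub>d\<close>: its \<open>n\<close>-th coefficient is already that of the \<open>n\<close>-th partial product if \<open>d > 0\<close>.\<close>
definition euler :: "nat \<Rightarrow> int fps" where
  "euler d = Abs_fps (\<lambda>n. fps_nth (qpoch (fps_X ^ d) n) n)"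

text \<open>Every additional factor \<open>1 - fps_X ^ (d * m)\<close> has \<open>m > L\<close> and
  so is 1 below degree \<open>d * Suc L\<close>.\<close>

lemma qpoch_agree:
  assumes "L \<le> L'"
  shows "fps_agree (d * Suc L) (qpoch (fps_X ^ d) L') (qpoch (fps_X ^ d) L :: int fps)"
  using assms
proof (induction L' rule: dec_induct)
  case (step n)
  have "fps_agree (d * Suc L) ((fps_X ^ d) ^ Suc n :: int fps) 0"
    unfolding power_mult[symmetric] by (rule fps_agree_X_power) (use step in simp)
  then have "fps_agree (d * Suc L) (1 - (fps_X ^ d) ^ Suc n :: int fps) (1 - 0)"
    by (intro fps_agree_diff fps_agree_refl)
  from fps_agree_mult[OF this step.IH] show ?case by simp
qed simp

lemma euler_agree:
  assumes "d \<ge> 1" "K \<le> d * Suc L"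
  shows "fps_agree K (euler d) (qpoch (fps_X ^ d) L)"
  unfolding fps_agree_def
proof (intro allI impI)
  fix i assume "i < K"
  then have i: "i < d * Suc L" "i < d * Suc i"
    using assms mult_le_mono1[of 1 d "Suc i"] by auto
  have "fps_nth (qpoch (fps_X ^ d) i) i = fps_nth (qpoch (fps_X ^ d) L :: int fps) i"
    using qpoch_agree[of i L d] qpoch_agree[of L i d] i
    by (cases "i \<le> L") (auto simp: fps_agree_def)
  then show "fps_nth (euler d) i = fps_nth (qpoch (fps_X ^ d) L) i"
    by (simp add: euler_def)
qed

lemma euler_nth_0 [simp]: "fps_nth (euler d) 0 = 1"
  by (simp add: euler_def)

lemma euler_neq_0 [simp]: "euler d \<noteq> 0"
  using euler_nth_0[of d] by (metis fps_zero_nth zero_neq_one)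

text \<open>For large \<open>k\<close> and \<open>m\<close> the three finite products in
  \<open>qbinom_qpoch\<close> all agree with \<open>euler d\<close>, so the Gaussian binomial tends
  to the inverse of \<open>euler d\<close>.\<close>

lemma qbinom_euler:
  assumes "d \<ge> 1" "r \<le> d * Suc k" "r \<le> d * Suc m"
  shows "fps_agree r (euler d * qbinom (fps_X ^ d) (k + m) k) 1"
proof -
  let ?q = "fps_X ^ d :: int fps"
  have "fps_agree r (euler d * euler d * qbinom ?q (k + m) k) (qpoch ?q k * qpoch ?q m * qbinom ?q (k + m) k)"
    using assms by (intro fps_agree_mult euler_agree fps_agree_refl)
  also have "\<dots> = qpoch ?q (k + m)" by (rule qbinom_qpoch)
  also have "fps_agree r (qpoch ?q (k + m)) (euler d)"
    by (rule fps_agree_sym, rule euler_agree) (use assms in \<open>auto simp: algebra_simps\<close>)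
  finally have "fps_agree r (euler d * (euler d * qbinom ?q (k + m) k)) (euler d * 1)"
    by (simp add: mult.assoc)
  then show ?thesis by (rule fps_agree_cancel_left[rotated]) simp
qed

text \<open>Passage to the limit in the finite triple product: near the centre the binomial is close
  to its limit, and far from the centre \<open>s n\<close> itself has high order. The order
  \<open>nat (abs n) - 1\<close>, one less than \<open>jacobi_exp_ge\<close> would give, is what
  \<open>jacobi_cube\<close> can provide.\<close>

lemma qbinom_sum_limit:
  assumes "d \<ge> 1" "\<And>n. fps_agree (nat \<bar>n\<bar> - 1) (s n) 0"
  shows "fps_agree N (euler d * (\<Sum>k\<le>N + N. qbinom (fps_X ^ d) (N + N) k * s (int k - int N)))
    (\<Sum>k\<le>N + N. s (int k - int N))"
  unfolding sum_distrib_left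
proof (rule fps_agree_sum)
  fix k assume "k \<in> {..N + N}"
  define m where "m = N + N - k"
  then have km: "N + N = k + m" using \<open>k \<in> _\<close> by simp
  let ?n = "int k - int N" and ?u = "euler d * qbinom (fps_X ^ d) (k + m) k"
  \<comment> \<open>The precision of the binomial; together with the order of \<open>s ?n\<close> it
    adds up to at least \<open>N\<close>.\<close>
  define r where "r = N + 1 - nat \<bar>?n\<bar>"
  have "r \<le> Suc k" "r \<le> Suc m" using km unfolding r_def by linarith+
  then have "r \<le> d * Suc k" "r \<le> d * Suc m"
    using assms(1) by (metis mult_le_mono1 mult_1 order_trans)+
  then have "fps_agree r (?u - 1) (1 - 1)"
    using assms(1) by (intro fps_agree_diff qbinom_euler fps_agree_refl)
  then have "fps_agree (r + (nat \<bar>?n\<bar> - 1)) ((?u - 1) * s ?n) 0"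
    using assms(2) by (intro fps_agree_0_mult) simp_all
  then have "fps_agree N ((?u - 1) * s ?n) 0"
    by (rule fps_agree_mono) (use km r_def in linarith)
  then have "fps_agree N ((?u - 1) * s ?n + s ?n) (0 + s ?n)"
    by (intro fps_agree_add fps_agree_refl)
  then show "fps_agree N (euler d * (qbinom (fps_X ^ d) (N + N) k * s ?n)) (s ?n)"
    unfolding km by (simp add: algebra_simps)
qed

lemma theta_ser_int_limit:
  fixes w :: "int \<Rightarrow> int"
  assumes "\<And>n. nat \<bar>n\<bar> \<le> e n + 1"
  shows "fps_agree N (\<Sum>k\<le>N + N. fps_const (w (int k - int N)) * fps_X ^ e (int k - int N))
    (theta_ser e UNIV w)"
  unfolding fps_agree_def
proof (intro allI impI)
  fix i assume i: "i < N"
  have "bij_betw (\<lambda>k. int k - int N) {..N + N} {- int N..int N}"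
    by (rule bij_betwI[where g = "\<lambda>n. nat (n + int N)"]) auto
  then have "(\<Sum>k\<le>N + N. if i = e (int k - int N) then w (int k - int N) else 0)
      = (\<Sum>n\<in>{- int N..int N}. if i = e n then w n else 0)"
    by (rule sum.reindex_bij_betw)
  also have "\<dots> = (\<Sum>n\<in>{n\<in>{- int N..int N}. e n = i}. w n)"
    by (subst sum.inter_filter[symmetric]) (auto intro!: sum.cong)
  also have "{n\<in>{- int N..int N}. e n = i} = {n \<in> UNIV. e n = i}"
    using assms i by (auto, (smt (verit) assms nat_le_iff of_nat_Suc Suc_eq_plus1 of_nat_less_iff)+)
  finally show "fps_nth (\<Sum>k\<le>N + N. fps_const (w (int k - int N)) * fps_X ^ e (int k - int N)) i
      = fps_nth (theta_ser e UNIV w) i"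
    by (simp add: fps_sum_nth theta_ser_nth if_distrib cong: if_cong)
qed

text \<open>For every integer \<open>n\<close> this is
  \<open>a * n + (a + b) * n * (n - 1) / 2\<close>; the second branch is rewritten so as to stay
  within the natural numbers.\<close>

definition jacobi_exp :: "nat \<Rightarrow> nat \<Rightarrow> int \<Rightarrow> nat" where
  "jacobi_exp a b n = (if n \<ge> 0 then a * nat n + (a + b) * (nat n choose 2)
     else b * nat (-n) + (a + b) * (nat (-n) choose 2))"

lemma fps_const_minus_one_power: "fps_const ((-1) ^ k) = (-1 :: 'a::comm_ring_1 fps) ^ k"
proof -
  have "fps_const (-1) = (-1 :: 'a fps)"
    by (rule fps_ext) simp
  then show ?thesis by (simp only: fps_const_power[symmetric])
qed

lemma jacobi_term_X:
  "jacobi_term (fps_X ^ a) (fps_X ^ b) n = fps_const ((-1) ^ nat \<bar>n\<bar>) * (fps_X ^ jacobi_exp a b n :: int fps)"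
  for a b :: nat
  by (auto simp: jacobi_term_def jacobi_exp_def fps_const_minus_one_power power_add power_mult mult.assoc)

lemma jacobi_exp_ge: "a \<ge> 1 \<Longrightarrow> b \<ge> 1 \<Longrightarrow> nat \<bar>n\<bar> \<le> jacobi_exp a b n"
  by (auto simp: jacobi_exp_def abs_if intro!: trans_le_add1)

theorem jacobi_triple_product:
  assumes "a \<ge> 1" "b \<ge> 1"
  shows "fps_agree N (euler (a + b) * ((\<Prod>k<N. 1 - fps_X ^ (a + (a + b) * k)) * (\<Prod>k<N. 1 - fps_X ^ (b + (a + b) * k))))
    (theta_ser (jacobi_exp a b) UNIV (\<lambda>n. (-1) ^ nat \<bar>n\<bar>))"
proof -
  let ?t = "jacobi_term (fps_X ^ a) (fps_X ^ b) :: int \<Rightarrow> int fps"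
  have t: "fps_agree (nat \<bar>n\<bar> - 1) (?t n) 0" for n
  proof -
    have "fps_agree (0 + (nat \<bar>n\<bar> - 1)) (fps_const ((-1) ^ nat \<bar>n\<bar>) * fps_X ^ jacobi_exp a b n) (0 :: int fps)"
      using jacobi_exp_ge[OF assms, of n]
      by (intro fps_agree_0_mult fps_agree_X_power) (auto simp: fps_agree_def)
    then show ?thesis by (simp add: jacobi_term_X)
  qed
  have "(\<Prod>k<N. 1 - fps_X ^ (a + (a + b) * k)) * (\<Prod>k<N. 1 - fps_X ^ (b + (a + b) * k))
      = (\<Sum>k\<le>N + N. qbinom (fps_X ^ (a + b)) (N + N) k * ?t (int k - int N))"
    using finite_jacobi_triple[of "fps_X ^ a :: int fps" "fps_X ^ b" N N]
    by (simp add: power_add[symmetric] power_mult[symmetric])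
  then have "fps_agree N (euler (a + b) * ((\<Prod>k<N. 1 - fps_X ^ (a + (a + b) * k)) * (\<Prod>k<N. 1 - fps_X ^ (b + (a + b) * k))))
      (\<Sum>k\<le>N + N. ?t (int k - int N))"
    using qbinom_sum_limit[of "a + b" ?t N] t assms by simp
  also have "fps_agree N (\<Sum>k\<le>N + N. ?t (int k - int N)) (theta_ser (jacobi_exp a b) UNIV (\<lambda>n. (-1) ^ nat \<bar>n\<bar>))"
    unfolding jacobi_term_X using jacobi_exp_ge[OF assms]
    by (intro theta_ser_int_limit) (simp add: le_SucI)
  finally show ?thesis .
qed

section \<open>Two theta series as quotients of Euler products\<close>

lemma qpoch_even_odd:
  "(\<Prod>k<N. 1 - fps_X ^ (d + 2 * d * k)) * qpoch (fps_X ^ (2 * d)) N = (qpoch (fps_X ^ d) (2 * N) :: int fps)"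
proof (induction N)
  case (Suc N)
  have "2 * Suc N = Suc (Suc (2 * N))" by simp
  moreover have "(fps_X ^ d) ^ Suc (2 * N) = (fps_X ^ (d + 2 * d * N) :: int fps)"
    "(fps_X ^ d) ^ Suc (Suc (2 * N)) = ((fps_X ^ (2 * d)) ^ Suc N :: int fps)"
    unfolding power_mult[symmetric] by (simp_all add: algebra_simps)
  ultimately have "qpoch (fps_X ^ d) (2 * Suc N) = (1 - (fps_X ^ (2 * d)) ^ Suc N)
      * ((1 - fps_X ^ (d + 2 * d * N)) * qpoch (fps_X ^ d) (2 * N) :: int fps)"
    by (simp only: qpoch_Suc)
  then show ?case unfolding Suc.IH[symmetric] by (simp only: qpoch_Suc prod.lessThan_Suc mult_ac)
qed simp

text \<open>The indices up to \<open>6 * N\<close> are sorted into the classes 1, 5 and 3 modulo 6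
  and the even numbers.\<close>

lemma qpoch_mod_6:
  "(\<Prod>k<N. 1 - fps_X ^ (d + 6 * d * k)) * (\<Prod>k<N. 1 - fps_X ^ (5 * d + 6 * d * k))
    * (\<Prod>k<N. 1 - fps_X ^ (3 * d + 2 * (3 * d) * k)) * qpoch (fps_X ^ (2 * d)) (3 * N)
   = (qpoch (fps_X ^ d) (6 * N) :: int fps)"
proof (induction N)
  case (Suc N)
  have "6 * Suc N = Suc (Suc (Suc (Suc (Suc (Suc (6 * N))))))" by simp
  moreover have "3 * Suc N = Suc (Suc (Suc (3 * N)))" by simp
  moreover have "(fps_X ^ d) ^ Suc (6 * N) = (fps_X ^ (d + 6 * d * N) :: int fps)"
    "(fps_X ^ d) ^ Suc (Suc (6 * N)) = ((fps_X ^ (2 * d)) ^ Suc (3 * N) :: int fps)"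
    "(fps_X ^ d) ^ Suc (Suc (Suc (6 * N))) = (fps_X ^ (3 * d + 2 * (3 * d) * N) :: int fps)"
    "(fps_X ^ d) ^ Suc (Suc (Suc (Suc (6 * N)))) = ((fps_X ^ (2 * d)) ^ Suc (Suc (3 * N)) :: int fps)"
    "(fps_X ^ d) ^ Suc (Suc (Suc (Suc (Suc (6 * N))))) = (fps_X ^ (5 * d + 6 * d * N) :: int fps)"
    "(fps_X ^ d) ^ Suc (Suc (Suc (Suc (Suc (Suc (6 * N)))))) = ((fps_X ^ (2 * d)) ^ Suc (Suc (Suc (3 * N))) :: int fps)"
    unfolding power_mult[symmetric] by (simp_all add: algebra_simps)
  ultimately have "qpoch (fps_X ^ d) (6 * Suc N)
      = (1 - (fps_X ^ (2 * d)) ^ Suc (Suc (Suc (3 * N)))) * ((1 - fps_X ^ (5 * d + 6 * d * N))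
        * ((1 - (fps_X ^ (2 * d)) ^ Suc (Suc (3 * N))) * ((1 - fps_X ^ (3 * d + 2 * (3 * d) * N))
        * ((1 - (fps_X ^ (2 * d)) ^ Suc (3 * N)) * ((1 - fps_X ^ (d + 6 * d * N))
        * (qpoch (fps_X ^ d) (6 * N) :: int fps))))))" and "3 * Suc N = Suc (Suc (Suc (3 * N)))"
    by (simp_all only: qpoch_Suc)
  then show ?case
    unfolding Suc.IH[symmetric] by (simp only: qpoch_Suc prod.lessThan_Suc mult_ac)
qed simp

text \<open>In Ramanujan's notation this is \<open>\<phi>(-q\<^sup>d)\<close>.\<close>
definition phi :: "nat \<Rightarrow> int fps" where
  "phi d = theta_ser (\<lambda>n::int. d * nat (n\<^sup>2)) UNIV (\<lambda>n. (-1) ^ nat \<bar>n\<bar>)"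

lemma square_eq_choose_2: "j + 2 * (j choose 2) = j * j"
  by (induction j) (simp_all add: choose_2_Suc binomial_eq_0)

lemma phi_eq: "phi d = theta_ser (jacobi_exp d d) UNIV (\<lambda>n. (-1) ^ nat \<bar>n\<bar>)"
proof -
  have "d * nat (n\<^sup>2) = jacobi_exp d d n" for n
  proof -
    define j where "j = nat \<bar>n\<bar>"
    have "jacobi_exp d d n = d * (j + 2 * (j choose 2))"
      by (auto simp: jacobi_exp_def j_def algebra_simps abs_if)
    also have "\<dots> = d * (j * j)" by (simp only: square_eq_choose_2)
    also have "j * j = nat (n\<^sup>2)"
      by (simp add: j_def power2_eq_square nat_mult_distrib[symmetric] flip: abs_mult)
    finally show ?thesis by simp
  qed
  then show ?thesis by (simp add: phi_def)
qed

lemma le_mult_Suc: "1 \<le> c \<Longrightarrow> N \<le> m \<Longrightarrow> N \<le> c * Suc m" for c N m :: nat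
  by (cases c) auto

text \<open>In the triple product with \<open>a = b = d\<close> both products run over the odd
  multiples of \<open>d\<close>, and each becomes \<open>euler d\<close> once the even multiples are
  supplied by \<open>euler (2 * d)\<close>.\<close>

lemma phi_euler:
  assumes "d \<ge> 1"
  shows "phi d * euler (2 * d) = (euler d)\<^sup>2"
proof (rule fps_eqI_agree)
  fix N
  let ?O = "\<Prod>k<N. 1 - fps_X ^ (d + 2 * d * k) :: int fps" and ?Q = "qpoch (fps_X ^ (2 * d)) N :: int fps"
  have E: "fps_agree N (euler (2 * d)) ?Q" "fps_agree N (qpoch (fps_X ^ d) (2 * N)) (euler d)"
    using assms by (auto intro!: euler_agree fps_agree_sym[OF euler_agree] le_mult_Suc simp del: mult_Suc_right)
  have "fps_agree N (phi d) (euler (2 * d) * (?O * ?O))"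
    unfolding phi_eq using jacobi_triple_product[of d d N] assms
    by - (rule fps_agree_sym, simp add: mult_2)
  then have "fps_agree N (phi d * euler (2 * d)) (euler (2 * d) * (?O * ?O) * euler (2 * d))"
    by (intro fps_agree_mult fps_agree_refl)
  also have "fps_agree N \<dots> (?Q * (?O * ?O) * ?Q)"
    using E by (intro fps_agree_mult fps_agree_refl)
  also have "?Q * (?O * ?O) * ?Q = (?O * ?Q)\<^sup>2"
    by (simp only: power2_eq_square mult_ac)
  also have "\<dots> = (qpoch (fps_X ^ d) (2 * N))\<^sup>2" by (simp only: qpoch_even_odd)
  also have "fps_agree N \<dots> ((euler d)\<^sup>2)" by (intro fps_agree_power E)
  finally show "fps_agree N (phi d * euler (2 * d)) ((euler d)\<^sup>2)" .
qed

text \<open>The triple product covers the classes 1 and 5 modulo 6; \<open>euler (2 * d)\<close> and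
  \<open>euler (3 * d)\<close> supply the others, the latter with a surplus factor
  \<open>euler (6 * d)\<close>. The case \<open>d = 3\<close> evaluates
  \<open>omega\<close>.\<close>

lemma theta_mod_6_euler:
  assumes "d \<ge> 1"
  shows "theta_ser (jacobi_exp d (5 * d)) UNIV (\<lambda>n. (-1) ^ nat \<bar>n\<bar>) * euler (2 * d) * euler (3 * d)
    = euler d * (euler (6 * d))\<^sup>2" (is "?B * _ * _ = _")
proof (rule fps_eqI_agree)
  fix N
  let ?R1 = "\<Prod>k<N. 1 - fps_X ^ (d + 6 * d * k) :: int fps"
    and ?R3 = "\<Prod>k<N. 1 - fps_X ^ (3 * d + 2 * (3 * d) * k) :: int fps"
    and ?R5 = "\<Prod>k<N. 1 - fps_X ^ (5 * d + 6 * d * k) :: int fps"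
    and ?Q = "\<lambda>d n. qpoch (fps_X ^ d) n :: int fps"
  have le: "N \<le> c * d * Suc (e * N)" if "c \<ge> 1" "e \<ge> 1" for c e
  proof -
    have "1 \<le> c * d" using that assms by (cases c; cases d) auto
    moreover have "N \<le> e * N" using that by (cases e) auto
    ultimately show ?thesis by (rule le_mult_Suc)
  qed
  have E: "fps_agree N (euler d) (?Q d (6 * N))" "fps_agree N (euler (2 * d)) (?Q (2 * d) (3 * N))"
    "fps_agree N (euler (3 * d)) (?Q (3 * d) (2 * N))" "fps_agree N (euler (6 * d)) (?Q (6 * d) N)"
    using assms le[of 1 6] le[of 2 3] le[of 3 2] le[of 6 1] by (intro euler_agree; simp)+
  have "fps_agree N (euler (6 * d) * (?R1 * ?R5)) ?B"
    using jacobi_triple_product[of d "5 * d" N] assms by simp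
  then have "fps_agree N ?B (euler (6 * d) * (?R1 * ?R5))" by (rule fps_agree_sym)
  then have "fps_agree N (?B * euler (2 * d) * euler (3 * d)) (euler (6 * d) * (?R1 * ?R5) * euler (2 * d) * euler (3 * d))"
    by (intro fps_agree_mult fps_agree_refl)
  also have "fps_agree N \<dots> (euler (6 * d) * (?R1 * ?R5) * ?Q (2 * d) (3 * N) * ?Q (3 * d) (2 * N))"
    using E by (intro fps_agree_mult fps_agree_refl)
  also have "?Q (3 * d) (2 * N) = ?R3 * ?Q (6 * d) N"
    using qpoch_even_odd[where d = "3 * d" and N = N] by simp
  also have "euler (6 * d) * (?R1 * ?R5) * ?Q (2 * d) (3 * N) * (?R3 * ?Q (6 * d) N)
      = (?R1 * ?R5 * ?R3 * ?Q (2 * d) (3 * N)) * (euler (6 * d) * ?Q (6 * d) N)"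
    by (simp only: mult_ac)
  also have "\<dots> = ?Q d (6 * N) * (euler (6 * d) * ?Q (6 * d) N)" by (simp only: qpoch_mod_6)
  also have "fps_agree N \<dots> (euler d * (euler (6 * d) * euler (6 * d)))"
    using E[THEN fps_agree_sym] by (intro fps_agree_mult fps_agree_refl)
  finally show "fps_agree N (?B * euler (2 * d) * euler (3 * d)) (euler d * (euler (6 * d))\<^sup>2)"
    by (simp only: power2_eq_square)
qed

section \<open>Jacobi's series for the cube of an Euler product\<close>

lemma qbinom_fps_const: "qbinom (fps_const q) n k = fps_const (qbinom q n k)"
  by (induction q n k rule: qbinom.induct) simp_all

lemma fps_nth_0_prod: "finite A \<Longrightarrow> fps_nth (prod f A) 0 = (\<Prod>x\<in>A. fps_nth (f x) 0)"
  by (induction A rule: finite_induct) simp_all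

text \<open>The coefficient of \<^term>\<open>fps_X\<close> in the finite triple product at \<open>z = 1 + fps_X\<close>, where
  the factor \<open>1 - z\<close> vanishes to first order.\<close>
lemma finite_jacobi_cube:
  fixes q :: "'a::comm_ring_1"
  defines "s \<equiv> \<lambda>n::int. if n \<ge> 0 then (-1) ^ nat n * of_nat (nat n) * q ^ (nat n choose 2)
     else - ((-1) ^ nat (-n) * of_nat (nat (-n)) * q ^ (nat (-n) + (nat (-n) choose 2)))"
  shows "- (qpoch q N * qpoch q (Suc N))
    = (\<Sum>k\<le>Suc N + Suc N. qbinom q (Suc N + Suc N) k * s (int k - int (Suc N)))"
proof -
  \<comment> \<open>\<open>w\<close> is the inverse of \<open>z\<close>; setting
    \<open>y = q * w\<close> keeps \<open>z * y\<close> equal to the constant \<open>q\<close>, so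
    the Gaussian binomials remain constants.\<close>
  define z w :: "'a fps" where "z = 1 + fps_X" and "w = Abs_fps (\<lambda>k. (-1) ^ k)"
  have zw: "z * w = 1"
    by (rule fps_ext) (auto simp: z_def w_def algebra_simps split: nat_diff_split
        dest!: gr0_implies_Suc)
  have z1: "fps_nth z 0 = 1" "fps_nth z 1 = 1" and w1: "fps_nth w 0 = 1" "fps_nth w 1 = -1"
    by (simp_all add: z_def w_def)
  define y where "y = fps_const q * w"
  have zy: "z * y = fps_const q" unfolding y_def mult.left_commute[of z] zw by simp
  have y_pow: "y ^ j = fps_const (q ^ j) * w ^ j" for j
    by (simp add: y_def power_mult_distrib)
  have q0: "(\<Prod>k<n. 1 - q * q ^ k) = qpoch q n" for n
    by (induction n) (simp_all add: mult.commute)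
  define R where "R = (\<Prod>k<N. 1 - z * fps_const q ^ Suc k) * (\<Prod>k<Suc N. 1 - y * fps_const q ^ k)"
  have "fps_nth R 0 = (\<Prod>k<N. 1 - q * q ^ k) * (\<Prod>k<Suc N. 1 - q * q ^ k)"
    unfolding R_def by (simp add: fps_nth_0_prod z1 y_def w1 del: prod.lessThan_Suc)
  then have R: "fps_nth R 0 = qpoch q N * qpoch q (Suc N)" by (simp only: q0)
  note sgn = fps_const_minus_one_power[symmetric]
  have t: "fps_nth (jacobi_term z y n) 1 = s n" for n
  proof (cases "n \<ge> 0")
    case True
    have "jacobi_term z y n
        = fps_const ((-1) ^ nat n) * z ^ nat n * fps_const (q ^ (nat n choose 2))"
      using True by (simp add: jacobi_term_def zy sgn)
    also have "\<dots> = fps_const ((-1) ^ nat n * q ^ (nat n choose 2)) * z ^ nat n"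
      by (simp only: fps_const_mult[symmetric] mult_ac)
    finally show ?thesis
      using True fps_power_first_eq[OF z1(1), of "nat n"] z1 by (simp add: s_def mult_ac)
  next
    case False
    have "jacobi_term z y n
        = fps_const ((-1) ^ nat (-n)) * (fps_const (q ^ nat (-n)) * w ^ nat (-n)) * fps_const (q ^ (nat (-n) choose 2))"
      using False by (simp add: jacobi_term_def zy sgn y_pow)
    also have "\<dots> = fps_const ((-1) ^ nat (-n) * q ^ (nat (-n) + (nat (-n) choose 2))) * w ^ nat (-n)"
      by (simp only: fps_const_mult[symmetric] power_add mult_ac)
    finally show ?thesis
      using False fps_power_first_eq[OF w1(1), of "nat (-n)"] w1 by (simp add: s_def mult_ac)
  qed
  \<comment> \<open>The factor for \<open>k = 0\<close> is \<open>1 - z = - fps_X\<close>, so the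
    coefficient of degree 1 sees only the constant term of the remaining product
    \<open>R\<close>.\<close>
  have "(\<Prod>k<Suc N. 1 - z * fps_const q ^ k) = (1 - z) * (\<Prod>k<N. 1 - z * fps_const q ^ Suc k)"
    by (subst prod.lessThan_Suc_shift) simp
  then have "(\<Prod>k<Suc N. 1 - z * (z * y) ^ k) * (\<Prod>k<Suc N. 1 - y * (z * y) ^ k) = - (fps_X * R)"
    unfolding R_def zy by (simp add: z_def mult.assoc del: prod.lessThan_Suc power_Suc)
  then have "- (fps_X * R)
      = (\<Sum>k\<le>Suc N + Suc N. qbinom (z * y) (Suc N + Suc N) k * jacobi_term z y (int k - int (Suc N)))"
    using finite_jacobi_triple[of z y "Suc N" "Suc N"] by simp
  then have "fps_nth (- (fps_X * R)) 1 = fps_nth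
      (\<Sum>k\<le>Suc N + Suc N. qbinom (z * y) (Suc N + Suc N) k * jacobi_term z y (int k - int (Suc N))) 1"
    by (rule arg_cong)
  then show ?thesis
    using R t by (simp only: fps_sum_nth zy qbinom_fps_const fps_mult_left_const_nth) simp
qed

text \<open>The limit of \<open>finite_jacobi_cube\<close> gives the negated cube as a sum over all
  integers with weights \<open>w\<close>. The indices \<open>n + 1\<close> and \<open>- n\<close>
  share their exponent, and their weights add up to
  \<open>- ((-1) ^ n * (2 * n + 1))\<close>.\<close>

theorem jacobi_cube:
  assumes "d \<ge> 1"
  shows "euler d ^ 3 = theta_ser (\<lambda>n::nat. d * (Suc n choose 2)) UNIV (\<lambda>n. (-1) ^ n * (2 * int n + 1))"
proof -
  define e :: "int \<Rightarrow> nat" where "e = (\<lambda>n. d * (if n \<ge> 0 then nat n choose 2 else Suc (nat (-n)) choose 2))"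
  define w :: "int \<Rightarrow> int" where "w = (\<lambda>n. (-1) ^ nat \<bar>n\<bar> * n)"
  let ?s = "\<lambda>n. fps_const (w n) * fps_X ^ e n"
  have c2: "m \<le> (m choose 2) + 1" for m
    by (induction m) (simp_all add: choose_2_Suc)
  have e: "nat \<bar>n\<bar> \<le> e n + 1" for n
  proof -
    have "m \<le> d * (m choose 2) + 1" "m \<le> d * (Suc m choose 2) + 1" for m
    proof -
      obtain d' where "d = Suc d'" using assms by (cases d) auto
      then show "m \<le> d * (m choose 2) + 1" "m \<le> d * (Suc m choose 2) + 1"
        using c2[of m] by (simp_all add: choose_2_Suc)
    qed
    then show ?thesis by (auto simp: e_def abs_if)
  qed
  have s_eq: "?s n = (if n \<ge> 0 then (-1) ^ nat n * of_nat (nat n) * (fps_X ^ d) ^ (nat n choose 2)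
     else - ((-1) ^ nat (-n) * of_nat (nat (-n)) * (fps_X ^ d) ^ (nat (-n) + (nat (-n) choose 2))))" for n
  proof -
    have sgn: "fps_const ((-1) ^ j * m) = (-1) ^ j * of_int m" for j and m :: int
      by (simp only: fps_const_mult[symmetric] fps_const_minus_one_power fps_of_int[symmetric] of_int_eq_id id_apply)
    show ?thesis
      by (auto simp: sgn w_def e_def abs_if choose_2_Suc power_mult[symmetric] simp flip: fps_const_neg)
  qed
  have ff: "finite_fibres e UNIV" using e by (intro finite_fibres_int)
  have "- (euler d ^ 3) = theta_ser e UNIV w"
  proof (rule fps_eqI_agree)
    fix N
    let ?q = "fps_X ^ d :: int fps"
    have N: "N \<le> d * Suc N" "N \<le> d * Suc (Suc N)"
      using assms by (auto intro!: le_mult_Suc simp del: mult_Suc_right)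
    have "fps_agree N (euler d * (0 - euler d * euler d)) (euler d * (0 - qpoch ?q N * qpoch ?q (Suc N)))"
      using assms N by (intro fps_agree_mult fps_agree_diff euler_agree fps_agree_refl)
    also have "0 - qpoch ?q N * qpoch ?q (Suc N) = - (qpoch ?q N * qpoch ?q (Suc N))" by simp
    also have "\<dots> = (\<Sum>k\<le>Suc N + Suc N. qbinom ?q (Suc N + Suc N) k * ?s (int k - int (Suc N)))"
      unfolding s_eq by (rule finite_jacobi_cube)
    also have "fps_agree N (euler d * \<dots>) (\<Sum>k\<le>Suc N + Suc N. ?s (int k - int (Suc N)))"
    proof (rule fps_agree_mono[OF qbinom_sum_limit[OF assms]])
      fix n
      have "fps_agree (0 + (nat \<bar>n\<bar> - 1)) (fps_const (w n) * fps_X ^ e n) 0"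
        using e[of n] by (intro fps_agree_0_mult fps_agree_X_power) (auto simp: fps_agree_def)
      then show "fps_agree (nat \<bar>n\<bar> - 1) (fps_const (w n) * fps_X ^ e n) 0" by simp
    qed simp
    also have "fps_agree N \<dots> (theta_ser e UNIV w)"
      by (rule fps_agree_mono[OF theta_ser_int_limit]) (use e in auto)
    finally show "fps_agree N (- (euler d ^ 3)) (theta_ser e UNIV w)"
      by (simp add: power3_eq_cube mult.assoc)
  qed
  also have "(UNIV :: int set) = {0<..} \<union> {..0}" by auto
  also have "theta_ser e \<dots> w = theta_ser e {0<..} w + theta_ser e {..0} w"
    using ff by (intro theta_ser_Un) (auto intro: finite_fibres_subset)
  also have "theta_ser e {0<..} w
      = theta_ser (\<lambda>n::nat. d * (Suc n choose 2)) UNIV (\<lambda>n. - ((-1) ^ n * (int n + 1)))"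
  proof (rule theta_ser_reindex[symmetric])
    show "bij_betw (\<lambda>n. int n + 1) UNIV {0<..}"
      by (rule bij_betwI[where g = "\<lambda>n. nat (n - 1)"]) auto
  qed (auto simp: e_def w_def nat_add_distrib)
  also have "theta_ser e {..0} w
      = theta_ser (\<lambda>n::nat. d * (Suc n choose 2)) UNIV (\<lambda>n. - ((-1) ^ n * int n))"
  proof (rule theta_ser_reindex[symmetric])
    show "bij_betw (\<lambda>n. - int n) UNIV {..0}"
      by (rule bij_betwI[where g = "\<lambda>n. nat (- n)"]) auto
  qed (auto simp: e_def w_def choose_2_Suc binomial_eq_0)
  finally have neg: "- (euler d ^ 3)
    = theta_ser (\<lambda>n::nat. d * (Suc n choose 2)) UNIV (\<lambda>n. - ((-1) ^ n * (int n + 1)))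
      + theta_ser (\<lambda>n::nat. d * (Suc n choose 2)) UNIV (\<lambda>n. - ((-1) ^ n * int n))" .
  show ?thesis
  proof (rule fps_ext)
    fix n
    have "- fps_nth (euler d ^ 3) n
      = - fps_nth (theta_ser (\<lambda>n::nat. d * (Suc n choose 2)) UNIV (\<lambda>n. (-1) ^ n * (2 * int n + 1))) n"
      using arg_cong[OF neg, of "\<lambda>f. fps_nth f n"]
      by (simp add: theta_ser_nth sum_negf[symmetric] sum.distrib[symmetric] algebra_simps)
    then show "fps_nth (euler d ^ 3) n
      = fps_nth (theta_ser (\<lambda>n::nat. d * (Suc n choose 2)) UNIV (\<lambda>n. (-1) ^ n * (2 * int n + 1))) n"
      by simp
  qed
qed

section \<open>Sections modulo 3 and the circulant norm\<close>

definition supp_mod3 :: "nat \<Rightarrow> 'a::zero fps \<Rightarrow> bool" where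
  "supp_mod3 r f \<longleftrightarrow> (\<forall>n. fps_nth f n \<noteq> 0 \<longrightarrow> n mod 3 = r mod 3)"

text \<open>Exponents are kept instead of being compressed to \<open>(n - r) / 3\<close>, so a
  series is the sum of its sections and these multiply as in a ring graded by the integers modulo
  3.\<close>

definition sect :: "nat \<Rightarrow> 'a::zero fps \<Rightarrow> 'a fps" where
  "sect r f = Abs_fps (\<lambda>n. if n mod 3 = r mod 3 then fps_nth f n else 0)"

lemma sect_nth: "fps_nth (sect r f) n = (if n mod 3 = r mod 3 then fps_nth f n else 0)"
  by (simp add: sect_def)

lemma supp_mod3_sect [simp]: "supp_mod3 r (sect r f)"
  by (simp add: supp_mod3_def sect_nth)

lemma sect_sum: "f = sect 0 f + sect 1 f + sect 2 (f :: 'a::comm_ring_1 fps)"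
proof (rule fps_ext)
  fix n :: nat
  have "n mod 3 = 0 \<or> n mod 3 = 1 \<or> n mod 3 = 2" by linarith
  then show "fps_nth f n = fps_nth (sect 0 f + sect 1 f + sect 2 f) n"
    by (auto simp: sect_nth)
qed

lemma sect_of_supp_mod3:
  "supp_mod3 s f \<Longrightarrow> sect r f = (if r mod 3 = s mod 3 then f else 0)"
  by (rule fps_ext) (auto simp: supp_mod3_def sect_nth)

lemma sect_add: "sect r (f + g) = sect r f + sect r (g :: 'a::comm_ring_1 fps)"
  by (rule fps_ext) (simp add: sect_nth)

lemma supp_mod3_mult:
  fixes f g :: "'a::comm_ring_1 fps"
  assumes "supp_mod3 r f" "supp_mod3 s g"
  shows "supp_mod3 (r + s) (f * g)"
  unfolding supp_mod3_def
proof (intro allI impI)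
  fix n assume "fps_nth (f * g) n \<noteq> 0"
  then obtain i where "i \<in> {0..n}" and nz: "fps_nth f i * fps_nth g (n - i) \<noteq> 0"
    unfolding fps_mult_nth by (rule sum.not_neutral_contains_not_neutral)
  then have "i \<le> n" "fps_nth f i \<noteq> 0" "fps_nth g (n - i) \<noteq> 0" by auto
  then have "i mod 3 = r mod 3" "(n - i) mod 3 = s mod 3"
    using assms by (auto simp: supp_mod3_def)
  then have "(i + (n - i)) mod 3 = (r + s) mod 3" by (rule mod_add_cong)
  then show "n mod 3 = (r + s) mod 3" using \<open>i \<le> n\<close> by simp
qed

lemma sect_mult:
  fixes f g :: "'a::comm_ring_1 fps"
  shows "sect 0 (f * g) = sect 0 f * sect 0 g + sect 1 f * sect 2 g + sect 2 f * sect 1 g"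
    and "sect 1 (f * g) = sect 0 f * sect 1 g + sect 1 f * sect 0 g + sect 2 f * sect 2 g"
    and "sect 2 (f * g) = sect 0 f * sect 2 g + sect 1 f * sect 1 g + sect 2 f * sect 0 g"
proof -
  have supp: "supp_mod3 (i + j) (sect i f * sect j g)" for i j
    by (intro supp_mod3_mult supp_mod3_sect)
  have "f * g = (sect 0 f + sect 1 f + sect 2 f) * (sect 0 g + sect 1 g + sect 2 g)"
    using sect_sum by metis
  then have fg: "f * g = sect 0 f * sect 0 g + sect 0 f * sect 1 g + sect 0 f * sect 2 g
     + (sect 1 f * sect 0 g + sect 1 f * sect 1 g + sect 1 f * sect 2 g)
     + (sect 2 f * sect 0 g + sect 2 f * sect 1 g + sect 2 f * sect 2 g)"
    by (simp only: distrib_left distrib_right add_ac)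
  note s = supp[THEN sect_of_supp_mod3]
  show "sect 0 (f * g) = sect 0 f * sect 0 g + sect 1 f * sect 2 g + sect 2 f * sect 1 g"
    and "sect 1 (f * g) = sect 0 f * sect 1 g + sect 1 f * sect 0 g + sect 2 f * sect 2 g"
    and "sect 2 (f * g) = sect 0 f * sect 2 g + sect 1 f * sect 1 g + sect 2 f * sect 0 g"
    unfolding fg sect_add s by simp_all
qed

section \<open>The circulant norm of Euler products\<close>

text \<open>The product of \<open>f(\<zeta> q)\<close> over the cube roots of unity \<open>\<zeta>\<close>, expressed without adjoining them.\<close>
definition norm3 :: "'a::comm_ring_1 fps \<Rightarrow> 'a fps" where
  "norm3 f = sect 0 f ^ 3 + sect 1 f ^ 3 + sect 2 f ^ 3 - 3 * sect 0 f * sect 1 f * sect 2 f"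

text \<open>The cubic form is the determinant of the circulant matrix of the three sections, and
  \<open>sect_mult\<close> is multiplication of circulants; multiplicativity of the determinant is
  checked as a polynomial identity.\<close>

lemma norm3_mult: "norm3 (f * g) = norm3 f * norm3 g"
proof -
  have "(a*x + b*z + c*y) ^ 3 + (a*y + b*x + c*z) ^ 3 + (a*z + b*y + c*x) ^ 3
      - 3 * (a*x + b*z + c*y) * (a*y + b*x + c*z) * (a*z + b*y + c*x)
    = (a^3 + b^3 + c^3 - 3*a*b*c) * (x^3 + y^3 + z^3 - 3*x*y*z)"
    for a b c x y z :: "'a fps"
    by (simp add: power3_eq_cube algebra_simps)
  then show ?thesis by (simp only: norm3_def sect_mult)
qed

lemma norm3_agree:
  assumes "fps_agree K f g" shows "fps_agree K (norm3 f) (norm3 g)"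
proof -
  have "fps_agree K (sect r f) (sect r g)" for r
    using assms by (simp add: fps_agree_def sect_nth)
  then show ?thesis
    unfolding norm3_def by (intro fps_agree_add fps_agree_diff fps_agree_mult fps_agree_power fps_agree_refl)
qed

lemma norm3_one [simp]: "norm3 1 = (1 :: 'a::comm_ring_1 fps)"
proof -
  have "supp_mod3 0 (1 :: 'a fps)" by (auto simp: supp_mod3_def split: if_splits)
  then show ?thesis by (simp add: norm3_def sect_of_supp_mod3)
qed

lemma supp_mod3_0_one_minus: "supp_mod3 0 (1 - fps_X ^ (3 * m) :: 'a::comm_ring_1 fps)"
  by (auto simp: supp_mod3_def fps_one_nth split: if_splits)

text \<open>For a primitive cube root of unity \<open>z\<close>, the powers of \<open>z ^ m\<close>
  run through all cube roots unless 3 divides \<open>m\<close>; in that case the three conjugates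
  coincide.\<close>

lemma norm3_one_minus_X_power:
  "norm3 (1 - fps_X ^ m :: 'a::comm_ring_1 fps) = (if 3 dvd m then (1 - fps_X ^ m) ^ 3 else 1 - fps_X ^ (3 * m))"
proof (cases "3 dvd m")
  case True
  then have "supp_mod3 0 (1 - fps_X ^ m :: 'a fps)"
    using supp_mod3_0_one_minus by (auto elim!: dvdE)
  then show ?thesis using True by (simp add: norm3_def sect_of_supp_mod3)
next
  case False
  then have m: "m mod 3 = 1 \<or> m mod 3 = 2" by presburger
  have s0: "sect 0 (1 - fps_X ^ m :: 'a fps) = 1"
    using False by (auto simp: fps_eq_iff sect_nth dvd_eq_mod_eq_0)
  have s1: "sect (m mod 3) (1 - fps_X ^ m :: 'a fps) = - (fps_X ^ m)"
    using False by (auto simp: fps_eq_iff sect_nth dvd_eq_mod_eq_0)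
  have s2: "sect (3 - m mod 3) (1 - fps_X ^ m :: 'a fps) = 0"
    using m by (auto simp: fps_eq_iff sect_nth)
  have "3 * m = m + m + m" by simp
  then have cube: "(- (fps_X ^ m)) ^ 3 = - (fps_X ^ (3 * m) :: 'a fps)"
    by (simp only: power_add power3_eq_cube) simp
  from m have "norm3 (1 - fps_X ^ m :: 'a fps) = 1 - fps_X ^ (3 * m)"
  proof
    assume "m mod 3 = 1"
    then have "sect 1 (1 - fps_X ^ m :: 'a fps) = - (fps_X ^ m)" "sect 2 (1 - fps_X ^ m :: 'a fps) = 0"
      using s1 s2 by simp_all
    then show ?thesis unfolding norm3_def s0 by (simp only: cube) simp
  next
    assume "m mod 3 = 2"
    then have "sect 2 (1 - fps_X ^ m :: 'a fps) = - (fps_X ^ m)" "sect 1 (1 - fps_X ^ m :: 'a fps) = 0"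
      using s1 s2 by simp_all
    then show ?thesis unfolding norm3_def s0 by (simp only: cube) simp
  qed
  then show ?thesis using False by simp
qed

text \<open>Factors with index prime to 3 have norm \<open>1 - fps_X ^ (3 * d * m)\<close>, those
  with index \<open>3 * j\<close> have norm \<open>(1 - fps_X ^ (3 * d * j)) ^ 3\<close>. The factor
  on the left fills the gaps at multiples of 3 in the first family.\<close>

lemma norm3_qpoch:
  assumes "\<not> 3 dvd d"
  shows "norm3 (qpoch (fps_X ^ d) (3 * N)) * qpoch (fps_X ^ (9 * d)) N
    = (qpoch (fps_X ^ (3 * d)) (3 * N) * qpoch (fps_X ^ (3 * d)) N ^ 3 :: int fps)"
proof (induction N)
  case (Suc N)
  have n3: "3 * Suc N = Suc (Suc (Suc (3 * N)))" by simp
  have "\<not> 3 dvd d * Suc (3 * N)" "\<not> 3 dvd d * Suc (Suc (3 * N))" "3 dvd d * Suc (Suc (Suc (3 * N)))"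
  proof -
    have "d * Suc (3 * N) = 3 * (d * N) + d" "d * Suc (Suc (3 * N)) = 3 * (d * N) + 2 * d"
      "d * Suc (Suc (Suc (3 * N))) = 3 * (d * Suc N)" by simp_all
    moreover have "\<not> 3 dvd 2 * d" using assms by presburger
    ultimately show "\<not> 3 dvd d * Suc (3 * N)" "\<not> 3 dvd d * Suc (Suc (3 * N))" "3 dvd d * Suc (Suc (Suc (3 * N)))"
      using assms by (simp_all only: dvd_add_right_iff dvd_triv_left simp_thms)
  qed
  then have norms: "norm3 (1 - (fps_X ^ d) ^ Suc (3 * N)) = (1 - (fps_X ^ (3 * d)) ^ Suc (3 * N) :: int fps)"
    "norm3 (1 - (fps_X ^ d) ^ Suc (Suc (3 * N))) = (1 - (fps_X ^ (3 * d)) ^ Suc (Suc (3 * N)) :: int fps)"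
    "norm3 (1 - (fps_X ^ d) ^ Suc (Suc (Suc (3 * N)))) = (1 - (fps_X ^ (3 * d)) ^ Suc N :: int fps) ^ 3"
    unfolding power_mult[symmetric] norm3_one_minus_X_power by (simp_all add: algebra_simps)
  have "(fps_X ^ (9 * d)) ^ Suc N = ((fps_X ^ (3 * d)) ^ Suc (Suc (Suc (3 * N))) :: int fps)"
    unfolding power_mult[symmetric] by (simp add: algebra_simps)
  then have "norm3 (qpoch (fps_X ^ d) (3 * Suc N)) * qpoch (fps_X ^ (9 * d)) (Suc N)
    = (1 - (fps_X ^ (3 * d)) ^ Suc N :: int fps) ^ 3 * (1 - (fps_X ^ (3 * d)) ^ Suc (Suc (3 * N)))
      * (1 - (fps_X ^ (3 * d)) ^ Suc (3 * N)) * (1 - (fps_X ^ (3 * d)) ^ Suc (Suc (Suc (3 * N))))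
      * (norm3 (qpoch (fps_X ^ d) (3 * N)) * qpoch (fps_X ^ (9 * d)) N)"
    unfolding n3 qpoch_Suc norm3_mult norms by (simp only: mult_ac)
  then show ?case
    unfolding Suc.IH unfolding n3 qpoch_Suc power_mult_distrib by (simp only: mult_ac)
qed simp

lemma norm3_euler:
  assumes "\<not> 3 dvd d"
  shows "norm3 (euler d) * euler (9 * d) = euler (3 * d) ^ 4"
proof (rule fps_eqI_agree)
  fix N
  have "d \<ge> 1" using assms by (cases d) auto
  then have E: "fps_agree N (euler d) (qpoch (fps_X ^ d) (3 * N))"
      "fps_agree N (euler (9 * d)) (qpoch (fps_X ^ (9 * d)) N)"
      "fps_agree N (qpoch (fps_X ^ (3 * d)) (3 * N)) (euler (3 * d))"
      "fps_agree N (qpoch (fps_X ^ (3 * d)) N) (euler (3 * d))"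
    by (auto intro!: euler_agree fps_agree_sym[OF euler_agree] le_mult_Suc simp del: mult_Suc_right)
  have "fps_agree N (norm3 (euler d) * euler (9 * d))
      (norm3 (qpoch (fps_X ^ d) (3 * N)) * qpoch (fps_X ^ (9 * d)) N)"
    using E by (intro fps_agree_mult norm3_agree)
  also have "\<dots> = qpoch (fps_X ^ (3 * d)) (3 * N) * qpoch (fps_X ^ (3 * d)) N ^ 3"
    by (rule norm3_qpoch[OF assms])
  also have "fps_agree N \<dots> (euler (3 * d) * euler (3 * d) ^ 3)"
    using E by (intro fps_agree_mult fps_agree_power)
  finally show "fps_agree N (norm3 (euler d) * euler (9 * d)) (euler (3 * d) ^ 4)"
    by (simp add: power_numeral_reduce)
qed

lemma supp_mod3_euler: "supp_mod3 0 (euler (3 * d))"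
proof -
  have "supp_mod3 0 (qpoch (fps_X ^ (3 * d)) n :: int fps)" for n
  proof (induction n)
    case (Suc n)
    have "supp_mod3 0 (1 - (fps_X ^ (3 * d)) ^ Suc n :: int fps)"
      unfolding power_mult[symmetric] mult.assoc by (rule supp_mod3_0_one_minus)
    from supp_mod3_mult[OF this Suc.IH] show ?case by simp
  qed (simp add: supp_mod3_def fps_one_nth)
  then show ?thesis by (auto simp: supp_mod3_def euler_def)
qed

section \<open>The 3-dissection\<close>

text \<open>The exponents are \<open>9 * n ^ 2 - 6 * n = (3 * n - 1) ^ 2 - 1\<close>, so
  \<open>fps_X * omega\<close> collects squares prime to 3.\<close>

abbreviation omega :: "int fps" where
  "omega \<equiv> theta_ser (jacobi_exp 3 15) UNIV (\<lambda>n. (-1) ^ nat \<bar>n\<bar>)"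

lemma int_jacobi_exp: "int (jacobi_exp 3 15 n) = 9 * n\<^sup>2 - 6 * n"
proof -
  define j where "j = nat \<bar>n\<bar>"
  have c: "2 * int (j choose 2) = int j * int j - int j"
    using arg_cong[OF square_eq_choose_2[of j], of int] by (simp add: algebra_simps)
  show ?thesis
  proof (cases "n \<ge> 0")
    case True
    then have "int (jacobi_exp 3 15 n) = 3 * int j + 9 * (2 * int (j choose 2))" "n = int j"
      by (simp_all add: jacobi_exp_def j_def)
    then show ?thesis unfolding c by (simp add: power2_eq_square algebra_simps)
  next
    case False
    then have "int (jacobi_exp 3 15 n) = 15 * int j + 9 * (2 * int (j choose 2))" "n = - int j"
      by (simp_all add: jacobi_exp_def j_def)
    then show ?thesis unfolding c by (simp add: power2_eq_square algebra_simps)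
  qed
qed

lemma minus_one_power_nat_abs: "(-1) ^ nat \<bar>n\<bar> = (if even n then 1 else -1 :: int)"
  by (simp add: minus_one_power_iff even_nat_iff)

text \<open>Splitting by \<open>n mod 3\<close>: multiples of 3 give \<open>phi 9\<close>, and the
  classes 1 and 2, exchanged by \<open>n\<close> to \<open>- n\<close>, give
  \<open>- (fps_X * omega)\<close> each, since \<open>1 - 3 * n\<close> and \<open>n\<close> have
  opposite parity.\<close>

lemma phi_dissection: "phi 1 = phi 9 - 2 * fps_X * omega"
proof -
  let ?e = "\<lambda>n::int. 1 * nat (n\<^sup>2)" and ?w = "\<lambda>n::int. (-1) ^ nat \<bar>n\<bar> :: int"
  let ?I = "\<lambda>r. {n::int. n mod 3 = r}"
  have "nat \<bar>n\<bar> \<le> nat (n\<^sup>2) + 0" for n :: int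
    by (simp add: nat_le_eq_zle) (metis abs_le_square_iff abs_power2 int_one_le_iff_zero_less self_le_power zero_less_abs_iff
       power2_abs pos2 abs_0 order_refl zero_power2)
  then have ff: "finite_fibres ?e I" for I
    by (intro finite_fibres_int[where c = 0]) simp
  have "phi 1 = theta_ser ?e (?I 0 \<union> (?I 1 \<union> ?I 2)) ?w"
    unfolding phi_def by (rule arg_cong2[where f = "\<lambda>I w. theta_ser ?e I w", OF _ refl]) auto
  also have "\<dots> = theta_ser ?e (?I 0) ?w + (theta_ser ?e (?I 1) ?w + theta_ser ?e (?I 2) ?w)"
    by (subst theta_ser_Un[OF ff ff], force, subst theta_ser_Un[OF ff ff], auto)
  also have "theta_ser ?e (?I 0) ?w = phi 9"
    unfolding phi_def
  proof (rule theta_ser_reindex[symmetric])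
    show "bij_betw (\<lambda>n. 3 * n) UNIV (?I 0)"
      by (rule bij_betwI[where g = "\<lambda>n. n div 3"]) auto
  qed (auto simp: power_mult_distrib nat_mult_distrib minus_one_power_nat_abs)
  also have "theta_ser ?e (?I 1) ?w = theta_ser (\<lambda>i. jacobi_exp 3 15 i + 1) UNIV (\<lambda>i. (-1) * ?w i)"
  proof (rule theta_ser_reindex[symmetric])
    show "bij_betw (\<lambda>n. 1 - 3 * n) UNIV (?I 1)"
      by (rule bij_betwI[where g = "\<lambda>n. (1 - n) div 3"]) (auto, presburger+)
    fix n :: int
    have "(1 - 3 * n)\<^sup>2 = int (jacobi_exp 3 15 n + 1)"
      by (simp add: int_jacobi_exp power2_eq_square algebra_simps)
    then show "1 * nat ((1 - 3 * n)\<^sup>2) = jacobi_exp 3 15 n + 1" by (simp only: nat_int mult_1)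
  qed (simp_all add: minus_one_power_nat_abs)
  also have "theta_ser ?e (?I 2) ?w = theta_ser (\<lambda>i. jacobi_exp 3 15 i + 1) UNIV (\<lambda>i. (-1) * ?w i)"
  proof (rule theta_ser_reindex[symmetric])
    show "bij_betw (\<lambda>n. 3 * n - 1) UNIV (?I 2)"
      by (rule bij_betwI[where g = "\<lambda>n. (n + 1) div 3"]) (auto, presburger+)
    fix n :: int
    have "(3 * n - 1)\<^sup>2 = int (jacobi_exp 3 15 n + 1)"
      by (simp add: int_jacobi_exp power2_eq_square algebra_simps)
    then show "1 * nat ((3 * n - 1)\<^sup>2) = jacobi_exp 3 15 n + 1" by (simp only: nat_int mult_1)
  qed (simp_all add: minus_one_power_nat_abs)
  also have "theta_ser (\<lambda>i. jacobi_exp 3 15 i + 1) UNIV (\<lambda>i. (-1) * ?w i) = - (fps_X * omega)"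
    unfolding theta_ser_shift[symmetric] theta_ser_cmult by (simp add: fps_eq_iff fps_X_mult_nth)
  finally show ?thesis
    by (simp only: mult_2 distrib_right diff_conv_add_uminus minus_add_distrib)
qed

lemma supp_mod3_theta_ser:
  assumes "\<And>i. i \<in> I \<Longrightarrow> e i mod 3 = r mod 3"
  shows "supp_mod3 r (theta_ser e I w)"
  unfolding supp_mod3_def using assms theta_ser_nth_eq_0 by metis

lemma sect_phi:
  shows "sect 0 (phi 1) = phi 9" "sect 1 (phi 1) = - (2 * fps_X * omega)" "sect 2 (phi 1) = 0"
proof -
  have 0: "supp_mod3 0 (phi 9)"
    unfolding phi_def by (rule supp_mod3_theta_ser) (simp add: mod_mult_left_eq[symmetric])
  have "supp_mod3 0 omega"
  proof (rule supp_mod3_theta_ser)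
    fix i
    have "int (jacobi_exp 3 15 i) = 3 * (3 * i\<^sup>2 - 2 * i)" by (simp add: int_jacobi_exp)
    then show "jacobi_exp 3 15 i mod 3 = 0 mod 3" by presburger
  qed
  moreover have "supp_mod3 1 (fps_X :: int fps)" by (auto simp: supp_mod3_def fps_X_nth)
  ultimately have "supp_mod3 (1 + 0) (fps_X * omega)" by (intro supp_mod3_mult)
  then have 1: "supp_mod3 1 (- (2 * fps_X * omega))"
    by (simp add: supp_mod3_def mult.assoc numeral_fps_const del: One_nat_def)
  show "sect 0 (phi 1) = phi 9" "sect 1 (phi 1) = - (2 * fps_X * omega)" "sect 2 (phi 1) = 0"
    unfolding phi_dissection diff_conv_add_uminus sect_add 0[THEN sect_of_supp_mod3] 1[THEN sect_of_supp_mod3]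
    by simp_all
qed

text \<open>\<open>F * phi 1 = euler 6\<close> lives in exponents divisible by 3, so its sections
  form a circulant linear system for those of \<open>F\<close>. Solving it for
  \<open>sect 2 F\<close> introduces the determinant \<open>a ^ 3 + c ^ 3\<close>, which is the norm
  of \<open>phi 1\<close>.\<close>

lemma sect_2_dissection:
  assumes F: "F * (euler 1)\<^sup>2 = euler 2 * euler 6"
  shows "sect 2 F * phi 3 ^ 3 = 4 * fps_X\<^sup>2 * euler 18 ^ 3"
proof -
  define a c where "a = phi 9" and "c = - (2 * fps_X * omega)"
  have s: "sect 0 (phi 1) = a" "sect 1 (phi 1) = c" "sect 2 (phi 1) = 0"
    using sect_phi by (simp_all only: a_def c_def)
  have phi1: "phi 1 * euler 2 = (euler 1)\<^sup>2" using phi_euler[of 1] by simp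
  have "euler 2 * (F * phi 1) = euler 2 * euler 6"
    using F phi1 by (simp add: mult_ac)
  then have "F * phi 1 = euler 6" by simp
  moreover have "supp_mod3 0 (euler 6)" using supp_mod3_euler[of 2] by simp
  ultimately have "sect r (F * phi 1) = (if r mod 3 = 0 then euler 6 else 0)" for r
    by (simp add: sect_of_supp_mod3)
  then have eqs: "sect 0 F * a + sect 2 F * c = euler 6" "sect 0 F * c + sect 1 F * a = 0"
    "sect 1 F * c + sect 2 F * a = 0"
    using sect_mult[of F "phi 1"] by (simp_all add: s del: One_nat_def)
  have F2: "sect 2 F * (a ^ 3 + c ^ 3) = euler 6 * c\<^sup>2"
  proof -
    have "sect 2 F * (a ^ 3 + c ^ 3) = a\<^sup>2 * (sect 1 F * c + sect 2 F * a)
        - a * c * (sect 0 F * c + sect 1 F * a) + c\<^sup>2 * (sect 0 F * a + sect 2 F * c)"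
      by (simp only: power2_eq_square power3_eq_cube algebra_simps)
    then show ?thesis using eqs by (simp add: mult.commute)
  qed
  have "norm3 (phi 1) * norm3 (euler 2) = (norm3 (euler 1))\<^sup>2"
    unfolding norm3_mult[symmetric] phi1 power2_eq_square ..
  moreover have "norm3 (phi 1) = a ^ 3 + c ^ 3" by (simp add: norm3_def s del: One_nat_def)
  moreover have "norm3 (euler 1) * euler 9 = euler 3 ^ 4" "norm3 (euler 2) * euler 18 = euler 6 ^ 4"
    using norm3_euler[of 1] norm3_euler[of 2] by simp_all
  \<comment> \<open>The norm of \<open>phi 1\<close> as an eta quotient, with denominators
    cleared.\<close>
  ultimately have D: "(a ^ 3 + c ^ 3) * euler 6 ^ 4 * (euler 9)\<^sup>2 = euler 3 ^ 8 * euler 18"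
    by algebra
  have om: "omega * euler 6 * euler 9 = euler 3 * (euler 18)\<^sup>2"
    using theta_mod_6_euler[of 3] by simp
  then have om2: "(omega * euler 6 * euler 9)\<^sup>2 = (euler 3 * (euler 18)\<^sup>2)\<^sup>2" by (rule arg_cong)
  have phi3: "phi 3 * euler 6 = (euler 3)\<^sup>2" using phi_euler[of 3] by simp
  \<comment> \<open>The prefactor is chosen so that \<open>D\<close> and the product formula for
    \<open>phi 3\<close> become applicable; it is nonzero and cancels at the end.\<close>
  have "(euler 3 ^ 8 * euler 18 * euler 6 ^ 3) * (sect 2 F * phi 3 ^ 3)
      = (sect 2 F * (a ^ 3 + c ^ 3)) * (phi 3 * euler 6) ^ 3 * euler 6 ^ 4 * (euler 9)\<^sup>2"
    unfolding D[symmetric] by (simp only: power_mult_distrib mult_ac)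
  also have "\<dots> = euler 6 * c\<^sup>2 * ((euler 3)\<^sup>2) ^ 3 * euler 6 ^ 4 * (euler 9)\<^sup>2"
    unfolding F2 phi3 ..
  also have "\<dots> = 4 * fps_X\<^sup>2 * euler 3 ^ 6 * euler 6 ^ 3 * (omega * euler 6 * euler 9)\<^sup>2"
    unfolding c_def by algebra
  also have "\<dots> = (euler 3 ^ 8 * euler 18 * euler 6 ^ 3) * (4 * fps_X\<^sup>2 * euler 18 ^ 3)"
    unfolding om2 by algebra
  finally show ?thesis by simp
qed

section \<open>The generating function\<close>

text \<open>Positive parts bound the size of a multiset by its sum.\<close>

lemma finite_fibres_sum_mset:
  assumes "finite P" "0 \<notin> P"
  shows "finite_fibres sum_mset {N :: nat multiset. set_mset N \<subseteq> P}"
  unfolding finite_fibres_def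
proof
  fix n
  have "{N \<in> {N. set_mset N \<subseteq> P}. \<Sum>\<^sub># N = n} \<subseteq> (\<Union>k\<le>n. multisets_of_size P k)"
  proof
    fix N assume N: "N \<in> {N \<in> {N. set_mset N \<subseteq> P}. \<Sum>\<^sub># N = n}"
    then have "\<forall>x\<in>#N. 1 \<le> x" using assms(2) by (auto simp: Suc_le_eq intro!: gr0I)
    then have "size N \<le> \<Sum>\<^sub># N" by (induction N) auto
    then show "N \<in> (\<Union>k\<le>n. multisets_of_size P k)" using N by (auto simp: multisets_of_size_def)
  qed
  then show "finite {N \<in> {N. set_mset N \<subseteq> P}. \<Sum>\<^sub># N = n}"
    by (rule finite_subset) (use assms(1) in auto)
qed

text \<open>Removing one copy of \<open>x\<close> matches the multisets containing \<open>x\<close>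
  with all multisets over \<open>insert x P\<close>; this gives a recurrence equivalent to
  multiplication by \<open>1 - fps_X ^ x\<close>.\<close>

lemma multiset_gf:
  assumes "finite P" "0 \<notin> P"
  shows "theta_ser sum_mset {N. set_mset N \<subseteq> P} (\<lambda>_. 1 :: int) * (\<Prod>x\<in>P. 1 - fps_X ^ x) = 1"
  using assms
proof (induction P rule: finite_induct)
  case empty
  have "{N :: nat multiset. set_mset N \<subseteq> {} \<and> \<Sum>\<^sub># N = n} = (if n = 0 then {{#}} else {})" for n
    by auto
  then show ?case by (auto simp: fps_eq_iff theta_ser_nth_one)
next
  case (insert x P)
  let ?M = "\<lambda>P. {N :: nat multiset. set_mset N \<subseteq> P}" and ?J = "{N. x \<in># N \<and> set_mset N \<subseteq> insert x P}"
  have ff: "finite_fibres sum_mset (?M (insert x P))"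
    using insert by (intro finite_fibres_sum_mset) auto
  have "?M (insert x P) = ?M P \<union> ?J" using insert.hyps by auto
  then have "theta_ser sum_mset (?M (insert x P)) (\<lambda>_. 1 :: int)
      = theta_ser sum_mset (?M P \<union> ?J) (\<lambda>_. 1)" by simp
  also have "\<dots> = theta_ser sum_mset (?M P) (\<lambda>_. 1) + theta_ser sum_mset ?J (\<lambda>_. 1)"
    using insert.hyps by (intro theta_ser_Un finite_fibres_subset[OF ff]) auto
  also have "theta_ser sum_mset ?J (\<lambda>_. 1 :: int) = theta_ser (\<lambda>N. \<Sum>\<^sub># N + x) (?M (insert x P)) (\<lambda>_. 1)"
  proof (rule theta_ser_reindex[symmetric])
    show "bij_betw (add_mset x) (?M (insert x P)) ?J"
      by (rule bij_betwI[where g = "\<lambda>N. N - {#x#}"]) (auto dest: in_diffD)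
  qed auto
  also have "\<dots> = fps_X ^ x * theta_ser sum_mset (?M (insert x P)) (\<lambda>_. 1)"
    by (rule theta_ser_shift[symmetric])
  finally have "theta_ser sum_mset (?M (insert x P)) (\<lambda>_. 1) * (1 - fps_X ^ x)
      = theta_ser sum_mset (?M P) (\<lambda>_. 1 :: int)" (is "?A * _ = ?B")
  proof -
    assume eq: "?A = ?B + fps_X ^ x * ?A"
    have "?A * (1 - fps_X ^ x) = ?A - fps_X ^ x * ?A"
      unfolding mult.commute[of ?A] by (simp only: left_diff_distrib mult_1_left)
    also have "\<dots> = ?B" by (subst (1) eq) simp
    finally show ?thesis .
  qed
  then have "theta_ser sum_mset (?M (insert x P)) (\<lambda>_. 1) * (\<Prod>x\<in>insert x P. 1 - fps_X ^ x)
      = theta_ser sum_mset (?M P) (\<lambda>_. 1 :: int) * (\<Prod>x\<in>P. 1 - fps_X ^ x)"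
    using insert.hyps by (simp add: mult.assoc[symmetric])
  also have "\<dots> = 1" using insert by auto
  finally show ?case .
qed

lemma finite_fibres_finite: "finite I \<Longrightarrow> finite_fibres e I"
  by (simp add: finite_fibres_def)

lemma subset_gf:
  assumes "finite P"
  shows "theta_ser (\<lambda>B. \<Sum>B) (Pow P) (\<lambda>_. 1 :: int) = (\<Prod>x\<in>P. 1 + fps_X ^ x)"
  using assms
proof (induction P rule: finite_induct)
  case empty
  have "{B :: nat set. B = {} \<and> \<Sum>B = n} = (if n = 0 then {{}} else {})" for n by auto
  then show ?case by (auto simp: fps_eq_iff theta_ser_nth_one)
next
  case (insert x P)
  let ?e = "\<lambda>B :: nat set. \<Sum>B"
  have "theta_ser ?e (Pow (insert x P)) (\<lambda>_. 1 :: int)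
      = theta_ser ?e (Pow P) (\<lambda>_. 1) + theta_ser ?e (insert x ` Pow P) (\<lambda>_. 1)"
    unfolding Pow_insert using insert.hyps by (intro theta_ser_Un finite_fibres_finite) auto
  also have "theta_ser ?e (insert x ` Pow P) (\<lambda>_. 1 :: int) = theta_ser (\<lambda>B. \<Sum>B + x) (Pow P) (\<lambda>_. 1)"
  proof (rule theta_ser_reindex[symmetric])
    show "bij_betw (insert x) (Pow P) (insert x ` Pow P)"
      using insert.hyps by (intro inj_on_imp_bij_betw) (auto simp: inj_on_def)
    fix B assume "B \<in> Pow P"
    then have "finite B" "x \<notin> B" using insert.hyps by (auto intro: finite_subset)
    then show "\<Sum>(insert x B) = \<Sum>B + x" by simp
  qed auto
  also have "\<dots> = fps_X ^ x * theta_ser ?e (Pow P) (\<lambda>_. 1)"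
    by (rule theta_ser_shift[symmetric])
  finally show ?case using insert by (simp add: algebra_simps)
qed

text \<open>Splitting off one overlined copy of every element of \<open>B\<close> leaves the multiset of
  non-overlined parts.\<close>
lemma Rbar_star_eq_card:
  assumes "n \<le> L"
  shows "Rbar_star l n = card {p \<in> {N. set_mset N \<subseteq> {x\<in>{1..L}. \<not> l dvd x}} \<times> Pow {1..L}.
      (case p of (N, B) \<Rightarrow> \<Sum>\<^sub># N + \<Sum>B) = n}" (is "_ = card ?T")
proof -
  have "bij_betw (\<lambda>(M, B). (M - mset_set B, B)) (overpartitions_R l n) ?T"
  proof (rule bij_betwI[where g = "\<lambda>(N, B). (N + mset_set B, B)"])
    show "(\<lambda>(M, B). (M - mset_set B, B)) \<in> overpartitions_R l n \<rightarrow> ?T"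
    proof (rule funcsetI)
      fix p assume "p \<in> overpartitions_R l n"
      moreover obtain M B where p: "p = (M, B)" by (cases p)
      ultimately have M: "\<forall>x\<in>#M. 0 < x" "\<Sum>\<^sub># M = n" "B \<subseteq> set_mset M"
        "\<forall>x\<in>#M. l dvd x \<longrightarrow> x \<in> B \<and> count M x = 1"
        by (auto simp: overpartitions_R_def)
      have finB: "finite B" using M(3) finite_subset by blast
      have le: "x \<in># M \<Longrightarrow> x \<le> L" for x
        using sum_mset.remove[of x M] M(2) assms by simp
      have "mset_set B \<subseteq># M"
        using M(3) finB by (auto simp: subseteq_mset_def count_mset_set' Suc_le_eq)
      then have "M = (M - mset_set B) + mset_set B" by (simp add: subset_mset.diff_add)
      from arg_cong[OF this, of sum_mset] have "\<Sum>\<^sub># (M - mset_set B) + \<Sum>B = n"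
        using M(2) by (simp add: sum_unfold_sum_mset)
      moreover have "x \<in> {1..L} \<and> \<not> l dvd x" if "x \<in># M - mset_set B" for x
      proof -
        have "x \<in># M" using that by (rule in_diffD)
        moreover have "count M x > count (mset_set B) x" using that by (simp add: in_diff_count)
        ultimately show ?thesis using M le finB by (auto simp: count_mset_set' Suc_le_eq split: if_splits)
      qed
      moreover have "B \<subseteq> {1..L}" using M(1,3) le by (auto simp: Suc_le_eq)
      ultimately show "(case p of (M, B) \<Rightarrow> (M - mset_set B, B)) \<in> ?T" by (auto simp: p)
    qed
    show "(\<lambda>(N, B). (N + mset_set B, B)) \<in> ?T \<rightarrow> overpartitions_R l n"
    proof (rule funcsetI)
      fix p assume "p \<in> ?T"
      moreover obtain N B where p: "p = (N, B)" by (cases p)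
      ultimately have N: "set_mset N \<subseteq> {x \<in> {1..L}. \<not> l dvd x}" and B: "B \<subseteq> {1..L}"
        and n: "\<Sum>\<^sub># N + \<Sum>B = n" by auto
      have finB: "finite B" using B finite_subset by blast
      show "(case p of (N, B) \<Rightarrow> (N + mset_set B, B)) \<in> overpartitions_R l n"
        unfolding p n[symmetric] using N B finB by (force simp: overpartitions_R_def sum_unfold_sum_mset count_mset_set' not_in_iff[symmetric])
    qed
    fix p assume "p \<in> overpartitions_R l n"
    then obtain M B where p: "p = (M, B)" "B \<subseteq> set_mset M" by (auto simp: overpartitions_R_def)
    then have "finite B" using finite_subset by blast
    then have "mset_set B \<subseteq># M"
      using p(2) by (auto simp: subseteq_mset_def count_mset_set' Suc_le_eq)
    then show "(case (case p of (M, B) \<Rightarrow> (M - mset_set B, B)) of (N, B) \<Rightarrow> (N + mset_set B, B)) = p"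
      using p by (simp add: subset_mset.diff_add)
  next
    fix p assume "p \<in> ?T"
    show "(case (case p of (N, B) \<Rightarrow> (N + mset_set B, B)) of (M, B) \<Rightarrow> (M - mset_set B, B)) = p"
      by (cases p) simp
  qed
  then show ?thesis unfolding Rbar_star_def by (rule bij_betw_same_card)
qed

lemma prod_multiples_qpoch:
  assumes "l \<ge> 1"
  shows "(\<Prod>x\<in>{x\<in>{1..l * N}. l dvd x}. 1 - fps_X ^ x) = (qpoch (fps_X ^ l) N :: int fps)"
proof -
  have "bij_betw (\<lambda>m. l * m) {1..N} {x\<in>{1..l * N}. l dvd x}"
    by (rule bij_betwI[where g = "\<lambda>x. x div l"]) (use assms in \<open>auto simp: Suc_le_eq elim!: dvdE\<close>)
  from prod.reindex_bij_betw[OF this, of "\<lambda>x. 1 - fps_X ^ x :: int fps"] show ?thesis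
    by (simp add: qpoch_def power_mult)
qed

text \<open>Non-overlined parts give the inverse of the product over \<open>?P\<close>, overlined
  parts the product of \<open>1 + fps_X ^ x\<close>. Multiplying by two copies of
  \<open>euler 1\<close> turns the latter into \<open>euler 2\<close> and leaves the multiples of
  \<open>l\<close> from the former.\<close>

theorem Rbar_star_gf:
  assumes "l \<ge> 1"
  shows "Abs_fps (\<lambda>n. int (Rbar_star l n)) * (euler 1)\<^sup>2 = euler 2 * euler l" (is "?F * _ = _")
proof (rule fps_eqI_agree)
  fix N
  \<comment> \<open>With this bound the multiples of \<open>l\<close> among the parts form exactly
    the \<open>N\<close>-th partial product of \<open>euler l\<close>.\<close>
  let ?L = "l * N"
  let ?P = "{x\<in>{1..?L}. \<not> l dvd x}" and ?D = "{x\<in>{1..?L}. l dvd x}"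
  let ?M = "theta_ser sum_mset {N. set_mset N \<subseteq> ?P} (\<lambda>_. 1 :: int)"
  have L: "N \<le> ?L" using assms by (cases l) auto
  have q1: "qpoch (fps_X ^ 1) ?L = (\<Prod>x\<in>{1..?L}. 1 - fps_X ^ x :: int fps)"
    by (simp add: qpoch_def)
  have q2: "(\<Prod>x\<in>{1..?L}. 1 + fps_X ^ x) * (\<Prod>x\<in>{1..?L}. 1 - fps_X ^ x) = (qpoch (fps_X ^ 2) ?L :: int fps)"
    unfolding qpoch_def prod.distrib[symmetric]
    by (rule prod.cong) (simp_all add: algebra_simps power_mult[symmetric] power_add[symmetric] mult_2)
  have "?M * theta_ser (\<lambda>B. \<Sum>B) (Pow {1..?L}) (\<lambda>_. 1)
      = theta_ser (\<lambda>(N, B). \<Sum>\<^sub># N + \<Sum>B) ({N. set_mset N \<subseteq> ?P} \<times> Pow {1..?L}) (\<lambda>_. 1)"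
    by (subst theta_ser_mult[OF finite_fibres_sum_mset finite_fibres_finite]) (auto simp: case_prod_unfold)
  then have MS: "?M * (\<Prod>x\<in>{1..?L}. 1 + fps_X ^ x)
      = theta_ser (\<lambda>(N, B). \<Sum>\<^sub># N + \<Sum>B) ({N. set_mset N \<subseteq> ?P} \<times> Pow {1..?L}) (\<lambda>_. 1)"
    by (simp only: subset_gf[OF finite_atLeastAtMost])
  have "fps_agree N ?F (?M * (\<Prod>x\<in>{1..?L}. 1 + fps_X ^ x))"
    unfolding fps_agree_def
  proof (intro allI impI)
    fix i assume "i < N"
    then have "i \<le> ?L" using L by (rule order_trans[OF less_imp_le])
    then show "fps_nth ?F i = fps_nth (?M * (\<Prod>x\<in>{1..?L}. 1 + fps_X ^ x)) i"
      unfolding MS theta_ser_nth_one Rbar_star_eq_card[OF \<open>i \<le> ?L\<close>, symmetric] by simp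
  qed
  moreover have E: "fps_agree N (euler 1) (\<Prod>x\<in>{1..?L}. 1 - fps_X ^ x)"
    unfolding q1[symmetric] by (rule euler_agree) (use L in \<open>simp_all add: le_SucI\<close>)
  ultimately have "fps_agree N (?F * (euler 1 * euler 1)) (?M * (\<Prod>x\<in>{1..?L}. 1 + fps_X ^ x)
      * ((\<Prod>x\<in>{1..?L}. 1 - fps_X ^ x) * (\<Prod>x\<in>{1..?L}. 1 - fps_X ^ x)))"
    by (intro fps_agree_mult)
  also have "\<dots> = (?M * (\<Prod>x\<in>{1..?L}. 1 - fps_X ^ x)) * qpoch (fps_X ^ 2) ?L"
    unfolding q2[symmetric] by (simp only: mult_ac)
  also have "(\<Prod>x\<in>{1..?L}. 1 - fps_X ^ x) = (\<Prod>x\<in>?P. 1 - fps_X ^ x) * (\<Prod>x\<in>?D. 1 - fps_X ^ x :: int fps)"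
    by (subst prod.union_disjoint[symmetric]) (auto intro!: prod.cong)
  also have "?M * \<dots> * qpoch (fps_X ^ 2) ?L
      = (?M * (\<Prod>x\<in>?P. 1 - fps_X ^ x)) * (\<Prod>x\<in>?D. 1 - fps_X ^ x :: int fps) * qpoch (fps_X ^ 2) ?L"
    by (simp only: mult.assoc)
  also have "\<dots> = qpoch (fps_X ^ 2) ?L * qpoch (fps_X ^ l) N"
    unfolding prod_multiples_qpoch[OF assms] by (subst multiset_gf) (auto simp: mult.commute)
  also have "fps_agree N \<dots> (euler 2 * euler l)"
    using L assms by (intro fps_agree_mult fps_agree_sym[OF euler_agree]) (auto intro: le_mult_Suc simp del: mult_Suc_right)
  finally show "fps_agree N (?F * (euler 1)\<^sup>2) (euler 2 * euler l)"
    by (simp only: power2_eq_square)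
qed

section \<open>Ternary forms and power series over the field with two elements\<close>

lemma bit_fps_add_self [simp]: "f + f = (0 :: bit fps)"
  by (rule fps_ext) (metis bit_2_eq_0 fps_add_nth fps_zero_nth mult_2 mult_zero_left)

lemma bit_fps_square_add: "(f + g)\<^sup>2 = f\<^sup>2 + (g :: bit fps)\<^sup>2"
proof -
  have "(f + g)\<^sup>2 = f\<^sup>2 + g\<^sup>2 + (f * g + f * g)"
    by (simp only: power2_eq_square algebra_simps)
  then show ?thesis by (simp only: bit_fps_add_self add_0_right)
qed

text \<open>Frobenius in characteristic 2: squaring substitutes \<open>fps_X ^ 2\<close> for
  \<open>fps_X\<close>. The induction peels off the constant coefficient.\<close>

lemma bit_fps_square_nth:
  "fps_nth (f\<^sup>2) n = (if even n then fps_nth f (n div 2) else (0 :: bit))"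
proof (induction n arbitrary: f rule: less_induct)
  case (less n)
  define c g where "c = fps_nth f 0" and "g = fps_shift 1 f"
  have f: "f = fps_const c + fps_X * g"
    by (rule fps_ext) (simp add: c_def g_def fps_X_mult_nth)
  have cc: "c\<^sup>2 = c" by (cases c) simp_all
  have "f\<^sup>2 = fps_const c + fps_X\<^sup>2 * g\<^sup>2"
    unfolding f bit_fps_square_add power_mult_distrib fps_const_power cc ..
  then have nth: "fps_nth (f\<^sup>2) n = (if n = 0 then c else 0) + (if n < 2 then 0 else fps_nth (g\<^sup>2) (n - 2))"
    by (simp add: fps_X_power_mult_nth)
  show ?case
  proof (cases "n < 2")
    case True
    then show ?thesis unfolding nth by (cases n) (auto simp: c_def)
  next
    case False
    then have "fps_nth (f\<^sup>2) n = (if even n then fps_nth g ((n - 2) div 2) else 0)"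
      unfolding nth using less.IH[of "n - 2" g] by simp
    moreover have "fps_nth g ((n - 2) div 2) = fps_nth f (n div 2)"
      using False by (simp add: g_def) (metis Suc_diff_Suc Suc_1 add_2_eq_Suc' div2_Suc_Suc le_add_diff_inverse2 not_less)
    ultimately show ?thesis by simp
  qed
qed

lemma theta_ser_square_bit:
  "(theta_ser e I (\<lambda>_. 1 :: bit))\<^sup>2 = theta_ser (\<lambda>i. 2 * e i) I (\<lambda>_. 1)"
proof (rule fps_ext)
  fix n
  show "fps_nth ((theta_ser e I (\<lambda>_. 1 :: bit))\<^sup>2) n = fps_nth (theta_ser (\<lambda>i. 2 * e i) I (\<lambda>_. 1)) n"
  proof (cases "even n")
    case True
    then have "{i \<in> I. 2 * e i = n} = {i \<in> I. e i = n div 2}" by auto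
    then show ?thesis using True by (simp add: bit_fps_square_nth theta_ser_nth_one)
  next
    case False
    then have "fps_nth (theta_ser (\<lambda>i. 2 * e i) I (\<lambda>_. 1 :: bit)) n = 0"
      by (intro theta_ser_nth_eq_0) auto
    then show ?thesis using False by (simp add: bit_fps_square_nth)
  qed
qed

lemma of_nat_bit_eq_0_iff: "(of_nat n :: bit) = 0 \<longleftrightarrow> even n"
  by (induction n) auto

lemma of_int_bit_eq_0_iff: "(of_int n :: bit) = 0 \<longleftrightarrow> even n"
proof -
  have "(of_int (2 * m) :: bit) = 0" "(of_int (2 * m + 1) :: bit) = 1" for m by simp_all
  then show ?thesis by (metis evenE oddE zero_neq_one)
qed

section \<open>Theta series of odd squares modulo 2\<close>

text \<open>Every odd square is the square of exactly one element of this set.\<close>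
definition odds :: "int set" where "odds = {s. s mod 4 = 1}"

definition sqr_ser :: "nat \<Rightarrow> int set \<Rightarrow> 'a::comm_semiring_1 fps" where
  "sqr_ser d I = theta_ser (\<lambda>n. d * nat (n\<^sup>2)) I (\<lambda>_. 1)"

lemma finite_fibres_sqr: "d \<ge> 1 \<Longrightarrow> finite_fibres (\<lambda>n. d * nat (n\<^sup>2)) I"
proof (rule finite_fibres_int[where c = 0])
  fix n :: int
  assume "d \<ge> 1"
  then have "1 * nat (n\<^sup>2) \<le> d * nat (n\<^sup>2)" by (rule mult_le_mono1)
  moreover have "nat \<bar>n\<bar> \<le> nat \<bar>n\<bar> * nat \<bar>n\<bar>" by (rule le_square)
  moreover have "nat \<bar>n\<bar> * nat \<bar>n\<bar> = nat (n\<^sup>2)"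
    by (simp add: power2_eq_square nat_mult_distrib[symmetric] flip: abs_mult)
  ultimately show "nat \<bar>n\<bar> \<le> d * nat (n\<^sup>2) + 0" by linarith
qed

lemma sqr_ser_Un: "d \<ge> 1 \<Longrightarrow> I \<inter> J = {} \<Longrightarrow> sqr_ser d (I \<union> J) = sqr_ser d I + sqr_ser d J"
  unfolding sqr_ser_def by (intro theta_ser_Un finite_fibres_sqr)

lemma sqr_ser_mult:
  assumes "c \<ge> 1" "d \<ge> 1"
  shows "sqr_ser c I * sqr_ser d J
    = theta_ser (\<lambda>(i, j). c * nat (i\<^sup>2) + d * nat (j\<^sup>2)) (I \<times> J) (\<lambda>_. 1)"
  unfolding sqr_ser_def using assms
  by (subst theta_ser_mult[OF finite_fibres_sqr finite_fibres_sqr]) (auto simp: case_prod_unfold)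

lemma sqr_ser_square: "(sqr_ser d I :: bit fps)\<^sup>2 = sqr_ser (2 * d) I"
  unfolding sqr_ser_def theta_ser_square_bit mult.assoc ..

lemma sqr_ser_UNIV: "d \<ge> 1 \<Longrightarrow> sqr_ser d UNIV = 1 + 2 * sqr_ser d {0<..}"
  unfolding sqr_ser_def by (subst theta_ser_even[OF finite_fibres_sqr]) simp_all

text \<open>Residues 1 and 5 modulo 8 correspond to squares 1 and 9 modulo 16.\<close>

lemma odds_split: "odds = {s. s mod 8 = 5} \<union> {s. s mod 8 = 1}" "{s. s mod 8 = 5} \<inter> {s::int. s mod 8 = 1} = {}"
  unfolding odds_def by (auto; presburger)+

lemma odds_positive:
  assumes "d \<ge> 1"
  shows "sqr_ser d {n. 0 < n \<and> odd n} = sqr_ser d odds"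
  unfolding sqr_ser_def
proof (rule theta_ser_reindex)
  show "bij_betw (\<lambda>n. if n mod 4 = 1 then n else - n) {n::int. 0 < n \<and> odd n} odds"
  proof (rule bij_betwI[where g = abs])
    show "(\<lambda>n. if n mod 4 = 1 then n else - n) \<in> {n::int. 0 < n \<and> odd n} \<rightarrow> odds"
      unfolding odds_def by (rule funcsetI) (simp; presburger)
    show "abs \<in> odds \<rightarrow> {n. 0 < n \<and> odd n}"
      unfolding odds_def by (rule funcsetI) (simp; presburger)
    show "(if \<bar>n\<bar> mod 4 = 1 then \<bar>n\<bar> else - \<bar>n\<bar>) = n" if "n \<in> odds" for n
    proof -
      have "n mod 4 = 1" using that by (simp add: odds_def)
      moreover from this have "- n mod 4 \<noteq> 1" by presburger
      ultimately show ?thesis by (cases "n \<ge> 0") simp_all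
    qed
  qed auto
qed auto

lemma sqr_ser_positive_split:
  assumes "d \<ge> 1"
  shows "sqr_ser d {0<..} = sqr_ser d {n. 0 < n \<and> odd n} + sqr_ser (4 * d) {0<..}"
proof -
  have "({0<..} :: int set) = {n. 0 < n \<and> odd n} \<union> {n. 0 < n \<and> even n}" by auto
  then have "sqr_ser d {0<..} = (sqr_ser d ({n. 0 < n \<and> odd n} \<union> {n. 0 < n \<and> even n}) :: 'a fps)" by simp
  also have "\<dots> = sqr_ser d {n. 0 < n \<and> odd n} + sqr_ser d {n. 0 < n \<and> even n}"
    using assms by (rule sqr_ser_Un) auto
  also have "sqr_ser d {n. 0 < n \<and> even n} = (sqr_ser (4 * d) {0<..} :: 'a fps)"
    unfolding sqr_ser_def
  proof (rule theta_ser_reindex[symmetric])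
    show "bij_betw (\<lambda>n. 2 * n) {0<..} {n::int. 0 < n \<and> even n}"
      by (rule bij_betwI[where g = "\<lambda>n. n div 2"]) auto
  qed (simp_all add: power_mult_distrib nat_mult_distrib)
  finally show ?thesis .
qed

text \<open>The parallelogram identity \<open>(a + 2b)\<^sup>2 + (a - 2b)\<^sup>2 = 2 a\<^sup>2 + 8 b\<^sup>2\<close>, where for odd \<open>a\<close> and \<open>b\<close>
  exactly one of \<open>a + 2b\<close> and \<open>a - 2b\<close> is congruent to 1 or 7 modulo 8.\<close>
lemma sqr_ser_parallelogram:
  "sqr_ser 1 {s. s mod 8 = 5} * sqr_ser 1 {s. s mod 8 = 1} = sqr_ser 2 odds * sqr_ser 8 odds"
proof -
  \<comment> \<open>For \<open>a\<close> congruent to 5 modulo 8 the sign of \<open>b\<close> is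
    switched, so that the first coordinate always lands in the class 5 and the second in the class
    1.\<close>
  let ?h = "\<lambda>(a::int, b). let b' = (if a mod 8 = 1 then b else - b) in (- a - 2 * b', 2 * b' - a)"
  let ?g = "\<lambda>(s::int, t). let a = - ((s + t) div 2); b = (t - s) div 4 in (a, if a mod 8 = 1 then b else - b)"
  have "theta_ser (\<lambda>(i, j). 2 * nat (i\<^sup>2) + 8 * nat (j\<^sup>2)) (odds \<times> odds) (\<lambda>_. 1)
    = theta_ser (\<lambda>(i, j). 1 * nat (i\<^sup>2) + 1 * nat (j\<^sup>2)) ({s. s mod 8 = 5} \<times> {s. s mod 8 = 1}) (\<lambda>_. 1 :: 'a)"
  proof (rule theta_ser_reindex)
    show "bij_betw ?h (odds \<times> odds) ({s. s mod 8 = 5} \<times> {s. s mod 8 = 1})"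
    proof (rule bij_betwI[where g = ?g])
      show "?h \<in> odds \<times> odds \<rightarrow> {s. s mod 8 = 5} \<times> {s. s mod 8 = 1}"
      proof (rule funcsetI)
        fix p assume "p \<in> odds \<times> odds"
        then obtain a b where p: "p = (a, b)" "a mod 4 = 1" "b mod 4 = 1"
          by (auto simp: odds_def)
        define j k where "j = b div 4" and "k = a div 4"
        have ab: "b = 4 * j + 1" "a = 4 * k + 1"
          using p mult_div_mod_eq[of 4 b] mult_div_mod_eq[of 4 a] by (simp_all add: j_def k_def)
        show "?h p \<in> {s. s mod 8 = 5} \<times> {s. s mod 8 = 1}"
        proof (cases "even k")
          case True
          then obtain m where "k = 2 * m" by (elim evenE)
          then have "a = 8 * m + 1" "- a - 2 * b = 8 * (- m - j - 1) + 5" "2 * b - a = 8 * (j - m) + 1"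
            using ab by simp_all
          then have "a mod 8 = 1" "(- a - 2 * b) mod 8 = 5" "(2 * b - a) mod 8 = 1"
            by (simp_all only: mod_mult_self4) simp_all
          then show ?thesis by (simp add: p)
        next
          case False
          then obtain m where "k = 2 * m + 1" by (elim oddE)
          then have "a = 8 * m + 5" "- a - 2 * (- b) = 8 * (j - m - 1) + 5" "2 * (- b) - a = 8 * (- m - j - 1) + 1"
            using ab by simp_all
          then have "a mod 8 = 5" "(- a - 2 * (- b)) mod 8 = 5" "(2 * (- b) - a) mod 8 = 1"
            by (simp_all only: mod_mult_self4) simp_all
          then show ?thesis by (simp add: p)
        qed
      qed
      have st: "\<exists>i j. s = 8 * i + 5 \<and> t = 8 * j + 1 \<and> (s + t) div 2 = 4 * i + 4 * j + 3 \<and> (t - s) div 4 = 2 * j - 2 * i - 1"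
        if "s mod 8 = 5" "t mod 8 = 1" for s t :: int
      proof -
        define i j where "i = s div 8" and "j = t div 8"
        have "s = 8 * i + 5" "t = 8 * j + 1"
          using that mult_div_mod_eq[of 8 s] mult_div_mod_eq[of 8 t] by (simp_all add: i_def j_def)
        moreover from this have "(s + t) div 2 = 4 * i + 4 * j + 3" "(t - s) div 4 = 2 * j - 2 * i - 1"
          by presburger+
        ultimately show ?thesis by blast
      qed
      show "?g \<in> {s. s mod 8 = 5} \<times> {s. s mod 8 = 1} \<rightarrow> odds \<times> odds"
      proof (rule funcsetI)
        fix p :: "int \<times> int" assume "p \<in> {s. s mod 8 = 5} \<times> {s. s mod 8 = 1}"
        then obtain s t where p: "p = (s, t)" "s mod 8 = 5" "t mod 8 = 1" by auto
        then obtain i j where ij: "(s + t) div 2 = 4 * i + 4 * j + 3" "(t - s) div 4 = 2 * j - 2 * i - 1"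
          using st by blast
        define a b where "a = - ((s + t) div 2)" and "b = (t - s) div 4"
        have "a mod 4 = 1 \<and> (if a mod 8 = 1 then b else - b) mod 4 = 1"
        proof (cases "even (i + j)")
          case True
          then obtain m where "i + j = 2 * m" by (elim evenE)
          then have "a = 8 * (- m - 1) + 5" "- b = 4 * (i - m) + 1"
            unfolding a_def b_def ij by simp_all
          then have a: "a mod 8 = 5" and "- b mod 4 = 1"
            by (simp_all only: mod_mult_self4) simp_all
          moreover have "a mod 4 = 1" using a by presburger
          ultimately show ?thesis by simp
        next
          case False
          then obtain m where "i + j = 2 * m + 1" by (elim oddE)
          then have "a = 8 * (- m - 1) + 1" "b = 4 * (m - i) + 1"
            unfolding a_def b_def ij by simp_all
          then have a: "a mod 8 = 1" and "b mod 4 = 1"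
            by (simp_all only: mod_mult_self4) simp_all
          moreover have "a mod 4 = 1" using a by presburger
          ultimately show ?thesis by simp
        qed
        moreover have "?g p = (a, if a mod 8 = 1 then b else - b)"
          unfolding p a_def b_def by (simp only: Let_def prod.case)
        ultimately show "?g p \<in> odds \<times> odds" by (simp add: odds_def)
      qed
      show "?g (?h p) = p" if "p \<in> odds \<times> odds" for p
      proof -
        have "- (2 * a) div 2 = - a" "- (4 * a) div 4 = - a" for a :: int by presburger+
        then show ?thesis by (cases p) (simp add: Let_def)
      qed
      show "?h (?g p) = p" if asm: "p \<in> {s. s mod 8 = 5} \<times> {s. s mod 8 = 1}" for p
      proof -
        obtain s t where p: "p = (s, t)" "s mod 8 = 5" "t mod 8 = 1" using asm by auto
        then obtain i j where "s = 8 * i + 5" "t = 8 * j + 1"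
          and ij: "(s + t) div 2 = 4 * i + 4 * j + 3" "(t - s) div 4 = 2 * j - 2 * i - 1"
          using st by blast
        moreover have "?h (a, if a mod 8 = 1 then b else - b) = (- a - 2 * b, 2 * b - a)" for a b
          by (simp add: Let_def)
        ultimately show ?thesis
          unfolding p(1) prod.case[of "\<lambda>s t. let a = - ((s + t) div 2); b = (t - s) div 4 in (a, if a mod 8 = 1 then b else - b)"]
            Let_def[of "- ((s + t) div 2)"] Let_def[of "(t - s) div 4"] by simp
      qed
    qed
    fix p :: "int \<times> int"
    show "(case ?h p of (i, j) \<Rightarrow> 1 * nat (i\<^sup>2) + 1 * nat (j\<^sup>2)) = (case p of (i, j) \<Rightarrow> 2 * nat (i\<^sup>2) + 8 * nat (j\<^sup>2))"
    proof -
      obtain a b where p: "p = (a, b)" by (cases p)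
      define b' where "b' = (if a mod 8 = 1 then b else - b)"
      have "(- a - 2 * b')\<^sup>2 + (2 * b' - a)\<^sup>2 = 2 * a\<^sup>2 + 8 * b'\<^sup>2"
        by (simp add: power2_eq_square algebra_simps)
      moreover have "b'\<^sup>2 = b\<^sup>2" by (simp add: b'_def)
      ultimately have "int (nat ((- a - 2 * b')\<^sup>2) + nat ((2 * b' - a)\<^sup>2)) = int (2 * nat (a\<^sup>2) + 8 * nat (b\<^sup>2))"
        by simp
      then show ?thesis
        unfolding p prod.case Let_def b'_def[symmetric] by (simp only: of_nat_eq_iff mult_1)
    qed
  qed auto
  then show ?thesis
    unfolding sqr_ser_mult[OF order_refl order_refl] sqr_ser_mult[OF one_le_numeral one_le_numeral]
    by (rule sym)
qed

text \<open>With \<open>T\<close> the series of the odd squares and \<open>W\<close> that of the numbers \<open>8 b\<^sup>2\<close> and \<open>16 b\<^sup>2\<close>,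
  one has \<open>W\<^sup>2 + W = T\<^sup>8\<close>, so that \<open>T W\<close> is a root of \<open>Y\<^sup>2 + T Y + T\<^bsup>10\<^esup>\<close>. The other root
  differs from it by \<open>T\<close>, and the series of the squares congruent to 9 modulo 16 is a root.\<close>
lemma odd_squares_mult_bit:
  "sqr_ser 1 odds * (sqr_ser 8 {0<..} + sqr_ser 16 {0<..}) = (sqr_ser 1 {s. s mod 8 = 5} :: bit fps)"
proof -
  define T where "T = (sqr_ser 1 odds :: bit fps)"
  define W where "W = (sqr_ser 8 {0<..} + sqr_ser 16 {0<..} :: bit fps)"
  define g h where "g = (sqr_ser 1 {s. s mod 8 = 5} :: bit fps)" and "h = (sqr_ser 1 {s. s mod 8 = 1} :: bit fps)"
  have T: "T = g + h"
    unfolding T_def g_def h_def odds_split(1) using odds_split(2) by (intro sqr_ser_Un) simp_all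
  have T2: "T\<^sup>2 = sqr_ser 2 odds" by (simp add: T_def sqr_ser_square)
  have "((T\<^sup>2)\<^sup>2)\<^sup>2 = sqr_ser 8 odds" by (simp add: T_def sqr_ser_square)
  then have gh: "g * h = T\<^sup>2 * ((T\<^sup>2)\<^sup>2)\<^sup>2"
    using sqr_ser_parallelogram[where 'a = bit] by (simp add: g_def h_def T2)
  have 8: "sqr_ser 8 {0<..} = sqr_ser 8 odds + (sqr_ser 32 {0<..} :: bit fps)"
    using sqr_ser_positive_split[of 8, where 'a = bit] odds_positive[of 8, where 'a = bit] by simp
  have "W\<^sup>2 = sqr_ser 16 {0<..} + sqr_ser 32 {0<..}"
    by (simp add: W_def bit_fps_square_add sqr_ser_square)
  then have "W\<^sup>2 + W = sqr_ser 8 odds + (sqr_ser 16 {0<..} + sqr_ser 16 {0<..}) + (sqr_ser 32 {0<..} + sqr_ser 32 {0<..})"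
    unfolding W_def 8 by (simp only: add_ac)
  then have W: "W\<^sup>2 + W = ((T\<^sup>2)\<^sup>2)\<^sup>2"
    by (simp only: bit_fps_add_self add_0_right T_def sqr_ser_square) simp
  have "(T * W + g) * (T * W + h) = T\<^sup>2 * W\<^sup>2 + T * W * (g + h) + g * h"
    by (simp only: power2_eq_square algebra_simps)
  also have "\<dots> = T\<^sup>2 * (W\<^sup>2 + W) + g * h"
    unfolding T[symmetric] by (simp only: power2_eq_square algebra_simps)
  also have "\<dots> = 0" unfolding W gh by simp
  finally have "T * W + g = 0 \<or> T * W + h = 0" by simp
  \<comment> \<open>The roots are told apart by the coefficient of degree 1: it is 1 in
    \<open>h\<close>, while \<open>T\<close> and \<open>W\<close> both lack a constant term.\<close>
  moreover have "T * W + h \<noteq> 0"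
  proof
    assume "T * W + h = 0"
    moreover have "fps_nth (sqr_ser d {0<..}) 0 = (0 :: bit)" if "d \<ge> 1" for d
      unfolding sqr_ser_def using that by (intro theta_ser_nth_eq_0) auto
    then have "fps_nth W 0 = 0" by (simp add: W_def)
    moreover have "fps_nth T 0 = 0"
      unfolding T_def sqr_ser_def by (intro theta_ser_nth_eq_0) (auto simp: odds_def)
    ultimately have "fps_nth (T * W) 1 = 0" "T * W + h = 0" by (simp_all add: fps_mult_nth_1)
    moreover have "{s::int. s mod 8 = 1 \<and> nat (s\<^sup>2) = 1} = {1}"
      by (auto simp: nat_eq_iff power2_eq_1_iff)
    then have "fps_nth h 1 = 1"
      by (simp add: h_def sqr_ser_def theta_ser_nth_one)
    ultimately show False by (metis fps_add_nth fps_zero_nth add_0_left zero_neq_one)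
  qed
  ultimately have "T * W + g = 0" by blast
  then have "T * W = g" by (metis add.assoc add_0_right add_0_left bit_fps_add_self)
  then show ?thesis by (simp add: T_def W_def g_def)
qed

lemma sqr_ser_mult3:
  assumes "b \<ge> 1" "c \<ge> 1" "d \<ge> 1"
  shows "sqr_ser b H * sqr_ser c I * sqr_ser d J
    = theta_ser (\<lambda>((h, i), j). b * nat (h\<^sup>2) + c * nat (i\<^sup>2) + d * nat (j\<^sup>2)) ((H \<times> I) \<times> J) (\<lambda>_. 1)"
  unfolding sqr_ser_mult[OF assms(1,2)] unfolding sqr_ser_def using assms
  by (subst theta_ser_mult[OF finite_fibres_prod[OF finite_fibres_sqr finite_fibres_sqr] finite_fibres_sqr])
    (auto simp: case_prod_unfold)

section \<open>Counting representations by ternary forms\<close>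

text \<open>The first variable is odd with its sign fixed by \<open>s mod 4 = 1\<close>, so each odd
  square counts once; the other two variables are arbitrary integers.\<close>

definition rep3 :: "nat \<Rightarrow> nat \<Rightarrow> nat \<Rightarrow> nat \<Rightarrow> ((int \<times> int) \<times> int) set" where
  "rep3 b c d M = {((s, n), m). s mod 4 = 1 \<and> int b * s\<^sup>2 + int c * n\<^sup>2 + int d * m\<^sup>2 = int M}"

lemma nat_sqr_sum_eq_iff:
  "b * nat (h\<^sup>2) + c * nat (i\<^sup>2) + d * nat (j\<^sup>2) = M \<longleftrightarrow> int b * h\<^sup>2 + int c * i\<^sup>2 + int d * j\<^sup>2 = int M"
  by (simp flip: of_nat_eq_iff[where 'a = int])

lemma card_rep3:
  assumes "b \<ge> 1" "c \<ge> 1" "d \<ge> 1"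
  shows "int (card (rep3 b c d M)) = fps_nth (sqr_ser b odds * sqr_ser c UNIV * sqr_ser d UNIV) M"
    and "finite (rep3 b c d M)"
proof -
  have "rep3 b c d M = {p \<in> (odds \<times> UNIV) \<times> UNIV. (case p of ((h, i), j) \<Rightarrow> b * nat (h\<^sup>2) + c * nat (i\<^sup>2) + d * nat (j\<^sup>2)) = M}"
    unfolding rep3_def by (auto simp: odds_def nat_sqr_sum_eq_iff)
  then show "int (card (rep3 b c d M)) = fps_nth (sqr_ser b odds * sqr_ser c UNIV * sqr_ser d UNIV) M"
    unfolding sqr_ser_mult3[OF assms] theta_ser_nth_one by (simp add: case_prod_unfold)
  have "finite_fibres (\<lambda>(p, j). (case p of (h, i) \<Rightarrow> b * nat (h\<^sup>2) + c * nat (i\<^sup>2)) + d * nat (j\<^sup>2)) ((odds \<times> UNIV) \<times> UNIV)"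
    using assms by (intro finite_fibres_prod finite_fibres_sqr)
  then show "finite (rep3 b c d M)"
    unfolding \<open>rep3 b c d M = _\<close> finite_fibres_def by (simp add: case_prod_unfold)
qed

text \<open>Writing the two full theta series as \<open>1 + 2 * ?Z d\<close>, the term without
  \<open>?Z\<close> vanishes since \<open>M\<close> is no square. An odd \<open>n\<close> would make
  \<open>s ^ 2 + 4 * n ^ 2\<close> congruent to 5 modulo 8, so \<open>?Z 4\<close> may be replaced
  by \<open>?Z 16\<close>, and \<open>odd_squares_mult_bit\<close> makes the coefficient of 2
  even.\<close>

lemma card_rep3_1_4_8:
  assumes "M mod 8 = 1" "\<And>t::int. t\<^sup>2 \<noteq> int M"
  shows "4 dvd card (rep3 1 4 8 M)"
proof -
  let ?T = "sqr_ser 1 odds" and ?Z = "\<lambda>d. sqr_ser d {0<..}"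
  have bitM: "fps_nth (?T * (?Z 8 + ?Z 16)) M = (0 :: bit)"
    unfolding odd_squares_mult_bit unfolding sqr_ser_def
    using assms(2) by (intro theta_ser_nth_eq_0) (auto simp: nat_eq_iff)
  have parity: "even (fps_nth (?T * ?Z d) M) \<longleftrightarrow> fps_nth (?T * ?Z d) M = (0 :: bit)" 
    if "d \<ge> 1" for d
    using that by (simp add: sqr_ser_mult theta_ser_nth_one of_nat_bit_eq_0_iff)
  have Z4: "?Z 4 = sqr_ser 4 {n. 0 < n \<and> odd n} + (?Z 16 :: int fps)"
    using sqr_ser_positive_split[of 4, where 'a = int] by simp
  have "fps_nth (?T * sqr_ser 4 {n. 0 < n \<and> odd n}) M = (0 :: int)"
  proof (subst sqr_ser_mult, simp, simp, rule theta_ser_nth_eq_0, rule notI)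
    fix p
    assume "p \<in> odds \<times> {n::int. 0 < n \<and> odd n}"
      and "(case p of (i, j) \<Rightarrow> 1 * nat (i\<^sup>2) + 4 * nat (j\<^sup>2)) = M"
    then obtain s n where "s \<in> odds" "odd n" and M: "1 * nat (s\<^sup>2) + 4 * nat (n\<^sup>2) = M" by auto
    have "odd s" using \<open>s \<in> odds\<close> unfolding odds_def mem_Collect_eq by presburger
    then obtain a b where "s = 2 * a + 1" "n = 2 * b + 1" using \<open>odd n\<close> by (elim oddE)
    moreover have "int M = s\<^sup>2 + 4 * n\<^sup>2" unfolding M[symmetric] by simp
    ultimately have "int M = 4 * (a * (a + 1)) + 16 * (b * (b + 1)) + 5"
      by (simp add: power2_eq_square algebra_simps)
    moreover have "even (a * (a + 1))" by simp
    ultimately have "\<exists>c k. int M = 4 * (2 * c) + 16 * k + 5" by (metis evenE)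
    moreover have "int M mod 8 = 1" using assms(1) by (metis zmod_int of_nat_1 of_nat_numeral)
    ultimately show False by presburger
  qed
  then have "fps_nth (?T * ?Z 4) M = (fps_nth (?T * ?Z 16) M :: int)"
    unfolding Z4 distrib_left by simp
  moreover have "fps_nth (?T * ?Z 8) M + fps_nth (?T * ?Z 16) M = (0 :: bit)"
    using bitM by (simp add: distrib_left)
  then have "even (fps_nth (?T * ?Z 8) M + fps_nth (?T * ?Z 16) M :: int)"
    using parity[of 8] parity[of 16] by (cases "fps_nth (?T * ?Z 8) M :: bit"; cases "fps_nth (?T * ?Z 16) M :: bit") auto
  ultimately have ev: "even (fps_nth (?T * ?Z 4) M + fps_nth (?T * ?Z 8) M :: int)" by simp
  have T0: "fps_nth ?T M = (0 :: int)"
    unfolding sqr_ser_def using assms(2) by (intro theta_ser_nth_eq_0) (auto simp: nat_eq_iff)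
  have "int (card (rep3 1 4 8 M)) = fps_nth (?T * sqr_ser 4 UNIV * sqr_ser 8 UNIV) M"
    by (rule card_rep3) simp_all
  also have "?T * sqr_ser 4 UNIV * sqr_ser 8 UNIV
      = ?T + fps_const 2 * (?T * ?Z 4 + ?T * ?Z 8) + fps_const (4 :: int) * (?T * ?Z 4 * ?Z 8)"
    by (simp add: sqr_ser_UNIV algebra_simps flip: numeral_fps_const)
  also have "fps_nth \<dots> M = 2 * (fps_nth (?T * ?Z 4) M + fps_nth (?T * ?Z 8) M) + 4 * fps_nth (?T * ?Z 4 * ?Z 8) M"
    by (simp add: T0 del: One_nat_def)
  also obtain v where v: "fps_nth (?T * ?Z 4) M + fps_nth (?T * ?Z 8) M = 2 * (v :: int)"
    using ev by (rule evenE)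
  finally have "int (card (rep3 1 4 8 M)) = 4 * (v + fps_nth (?T * ?Z 4 * ?Z 8) M)"
    unfolding v by simp
  then have "4 dvd int (card (rep3 1 4 8 M))" by (rule dvdI)
  then show ?thesis by presburger
qed

section \<open>Arithmetic at the prime 3\<close>

lemma square_mod_3: "(x::int)\<^sup>2 mod 3 = (if 3 dvd x then 0 else 1)"
proof -
  have "x mod 3 = 0 \<or> x mod 3 = 1 \<or> x mod 3 = 2" by presburger
  moreover have sq: "x\<^sup>2 mod 3 = (x mod 3)\<^sup>2 mod 3" by (simp add: power_mod)
  have "x\<^sup>2 mod 3 = r\<^sup>2 mod 3" if "x mod 3 = r" for r using sq that by (simp only:)
  ultimately show ?thesis by (fastforce simp: dvd_eq_mod_eq_0)
qed

text \<open>As -1 is not a square modulo 3, both \<open>n\<close> and \<open>m\<close> are divisible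
  by 3. For \<open>k > 0\<close> then so is \<open>t\<close>, and dividing by 9 lowers
  \<open>k\<close>; for \<open>k = 0\<close> the non-residue \<open>u\<close> would be a square
  modulo 3.\<close>

lemma no_ternary_rep:
  fixes t n m u :: int
  assumes "u mod 3 = 2"
  shows "3 * t\<^sup>2 + 4 * n\<^sup>2 + 4 * m\<^sup>2 \<noteq> 3 * (9 ^ k * u)"
proof (induction k arbitrary: t n m)
  have descent: "\<exists>y z. n = 3 * y \<and> m = 3 * z \<and> t\<^sup>2 + 12 * y\<^sup>2 + 12 * z\<^sup>2 = v"
    if eq: "3 * t\<^sup>2 + 4 * n\<^sup>2 + 4 * m\<^sup>2 = 3 * v" for t n m v :: int
  proof -
    have "n\<^sup>2 + m\<^sup>2 = 3 * (v - t\<^sup>2 - n\<^sup>2 - m\<^sup>2)" using eq by algebra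
    then have "(n\<^sup>2 + m\<^sup>2) mod 3 = 0" by (metis mod_mult_self1_is_0)
    then have "(n\<^sup>2 mod 3 + m\<^sup>2 mod 3) mod 3 = 0" by (simp add: mod_add_eq)
    then have "3 dvd n" "3 dvd m" unfolding square_mod_3 by (auto split: if_splits)
    then obtain y z where yz: "n = 3 * y" "m = 3 * z" by (elim dvdE)
    then have "t\<^sup>2 + 12 * y\<^sup>2 + 12 * z\<^sup>2 = v" using eq by (simp add: power_mult_distrib)
    with yz show ?thesis by blast
  qed
  {
    case (0 t n m)
    show ?case
    proof
      assume "3 * t\<^sup>2 + 4 * n\<^sup>2 + 4 * m\<^sup>2 = 3 * (9 ^ 0 * u)"
      then obtain y z where "t\<^sup>2 + 12 * y\<^sup>2 + 12 * z\<^sup>2 = u" using descent[of t n m u] by auto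
      then have "u = t\<^sup>2 + 3 * (4 * y\<^sup>2 + 4 * z\<^sup>2)" by simp
      then have "u mod 3 = t\<^sup>2 mod 3" by (simp only: mod_mult_self2)
      then show False using assms by (simp add: square_mod_3 split: if_splits)
    qed
  next
    case (Suc k t n m)
    show ?case
    proof
      assume "3 * t\<^sup>2 + 4 * n\<^sup>2 + 4 * m\<^sup>2 = 3 * (9 ^ Suc k * u)"
      then obtain y z where yz: "t\<^sup>2 + 12 * y\<^sup>2 + 12 * z\<^sup>2 = 9 * (9 ^ k * u)"
        using descent[of t n m "9 ^ Suc k * u"] by (auto simp: mult.assoc)
      then have "t\<^sup>2 = 3 * (3 * (9 ^ k * u) - 4 * y\<^sup>2 - 4 * z\<^sup>2)" by simp
      then have "t\<^sup>2 mod 3 = 0" by (metis mod_mult_self1_is_0)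
      then have "3 dvd t" by (simp add: square_mod_3 split: if_splits)
      then obtain x where "t = 3 * x" by (elim dvdE)
      then have "3 * x\<^sup>2 + 4 * y\<^sup>2 + 4 * z\<^sup>2 = 3 * (9 ^ k * u)"
        using yz by (simp add: power_mult_distrib)
      then show False using Suc.IH by blast
    qed
  }
qed

text \<open>Multiplication by \<open>1 + sqrt (-2)\<close> and by its conjugate: the numbers \<open>n + m * sqrt (-2)\<close>
  with norm divisible by 3 are the multiples of one of the two primes above 3.\<close>
lemma card_rep3_mult_3:
  "card (rep3 3 4 8 (3 * M)) + card (rep3 1 12 24 M) = 2 * card (rep3 1 4 8 M)"
proof -
  define R where "R = rep3 3 4 8 (3 * M)"
  define A where "A = {((s, n), m). ((s, n), m) \<in> R \<and> 3 dvd n - m}"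
  define B where "B = {((s, n), m). ((s, n), m) \<in> R \<and> 3 dvd n + m}"
  have finR: "finite R" unfolding R_def by (rule card_rep3) simp_all
  have R_iff: "((s, n), m) \<in> R \<longleftrightarrow> s mod 4 = 1 \<and> 3 * s\<^sup>2 + 4 * n\<^sup>2 + 8 * m\<^sup>2 = 3 * int M" for s n m
    by (simp add: R_def rep3_def)
  have "3 dvd n - m \<or> 3 dvd n + m" if "((s, n), m) \<in> R" for s n m
  proof -
    have "(n - m) * (n + m) = n\<^sup>2 - m\<^sup>2" by (simp add: power2_eq_square algebra_simps)
    also have "\<dots> = 3 * (int M - s\<^sup>2 - n\<^sup>2 - 3 * m\<^sup>2)" using that unfolding R_iff by algebra
    finally have "3 dvd (n - m) * (n + m)" by (rule dvdI)
    then show ?thesis by (simp add: prime_dvd_mult_iff)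
  qed
  then have RAB: "R = A \<union> B" by (auto simp: A_def B_def)
  have "finite A" "finite B"
    using finR by (auto simp: A_def B_def elim!: finite_subset[rotated])
  then have "card A + card B = card R + card (A \<inter> B)"
    unfolding RAB by (rule card_Un_Int)
  \<comment> \<open>\<open>(a + b * sqrt (-2)) * (1 + sqrt (-2))\<close> has components
    \<open>a - 2 * b\<close> and \<open>a + b\<close>.\<close>
  moreover have "bij_betw (\<lambda>((s, a), b). ((s, a - 2 * b), a + b)) (rep3 1 4 8 M) A"
  proof (rule bij_betwI[where g = "\<lambda>((s, n), m). ((s, (n + 2 * m) div 3), (m - n) div 3)"])
    show "(\<lambda>((s, a), b). ((s, a - 2 * b), a + b)) \<in> rep3 1 4 8 M \<rightarrow> A"
      by (auto simp: A_def R_iff rep3_def power2_eq_square algebra_simps)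
    show "(\<lambda>((s, n), m). ((s, (n + 2 * m) div 3), (m - n) div 3)) \<in> A \<rightarrow> rep3 1 4 8 M"
    proof (rule funcsetI)
      fix p assume "p \<in> A"
      then obtain s n m where p: "p = ((s, n), m)" "((s, n), m) \<in> R" "3 dvd n - m" by (auto simp: A_def)
      then obtain d where "n = m + 3 * d" by (metis dvdE diff_eq_eq add.commute)
      then have "(n + 2 * m) div 3 = m + d" "(m - n) div 3 = - d" "n = m + 3 * d" by presburger+
      then show "(\<lambda>((s, n), m). ((s, (n + 2 * m) div 3), (m - n) div 3)) p \<in> rep3 1 4 8 M"
        using p(2) unfolding R_iff by (simp add: p(1) rep3_def power2_eq_square algebra_simps)
    qed
    show "(\<lambda>((s, n), m). ((s, (n + 2 * m) div 3), (m - n) div 3)) ((\<lambda>((s, a), b). ((s, a - 2 * b), a + b)) p) = p" for p :: "(int \<times> int) \<times> int"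
      by (auto split: prod.splits)
    show "(\<lambda>((s, a), b). ((s, a - 2 * b), a + b)) ((\<lambda>((s, n), m). ((s, (n + 2 * m) div 3), (m - n) div 3)) p) = p" if asm: "p \<in> A" for p
    proof -
      obtain s n m where p: "p = ((s, n), m)" "3 dvd n - m" using asm by (auto simp: A_def)
      then obtain d where "n = m + 3 * d" by (metis dvdE diff_eq_eq add.commute)
      then have "(n + 2 * m) div 3 = m + d" "(m - n) div 3 = - d" "n = m + 3 * d" by presburger+
      then show ?thesis unfolding p(1) by simp
    qed
  qed
  then have "card A = card (rep3 1 4 8 M)" by (simp add: bij_betw_same_card)
  moreover have "bij_betw (\<lambda>((s, n), m). ((s, - n), m)) A B"
    by (rule bij_betwI[where g = "\<lambda>((s, n), m). ((s, - n), m)"]) (auto simp: A_def B_def R_iff, presburger+)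
  then have "card B = card A" by (simp add: bij_betw_same_card)
  \<comment> \<open>In the intersection both \<open>n\<close> and \<open>m\<close> are multiples of
    3; dividing them by 3 and the equation by 3 gives the form with coefficients 1, 12, 24.\<close>
  moreover have "bij_betw (\<lambda>((s, n), m). ((s, 3 * n), 3 * m)) (rep3 1 12 24 M) (A \<inter> B)"
  proof (rule bij_betwI[where g = "\<lambda>((s, n), m). ((s, n div 3), m div 3)"])
    show "(\<lambda>((s, n), m). ((s, 3 * n), 3 * m)) \<in> rep3 1 12 24 M \<rightarrow> A \<inter> B"
      by (auto simp: A_def B_def R_iff rep3_def power_mult_distrib; presburger)
    have AB: "\<exists>s n m. p = ((s, 3 * n), 3 * m) \<and> ((s, 3 * n), 3 * m) \<in> R" if asm: "p \<in> A \<inter> B" for p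
    proof -
      obtain s n m where p: "p = ((s, n), m)" "((s, n), m) \<in> R" "3 dvd n - m" "3 dvd n + m"
        using asm by (auto simp: A_def B_def)
      then have "3 dvd n" "3 dvd m" by presburger+
      then show ?thesis using p by (auto elim!: dvdE)
    qed
    show "(\<lambda>((s, n), m). ((s, n div 3), m div 3)) \<in> A \<inter> B \<rightarrow> rep3 1 12 24 M"
      using AB by (auto simp: R_iff rep3_def power_mult_distrib dest!: AB)
    show "(\<lambda>((s, n), m). ((s, n div 3), m div 3)) ((\<lambda>((s, n), m). ((s, 3 * n), 3 * m)) p) = p"
      for p :: "(int \<times> int) \<times> int"
      by (auto split: prod.splits)
    show "(\<lambda>((s, n), m). ((s, 3 * n), 3 * m)) ((\<lambda>((s, n), m). ((s, n div 3), m div 3)) p) = p"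
      if "p \<in> A \<inter> B" for p
      using AB[OF that] by auto
  qed
  then have "card (A \<inter> B) = card (rep3 1 12 24 M)" by (simp add: bij_betw_same_card)
  ultimately show ?thesis unfolding R_def by linarith
qed

text \<open>Modulo 3 the first variable must be divisible by 3. The factor is -3 and not 3 because
  it has to preserve the class 1 modulo 4.\<close>

lemma card_rep3_mult_9: "card (rep3 1 12 24 (9 * M)) = card (rep3 3 4 8 (3 * M))"
proof -
  have "bij_betw (\<lambda>((s, n), m). ((- 3 * s, n), m)) (rep3 3 4 8 (3 * M)) (rep3 1 12 24 (9 * M))"
  proof (rule bij_betwI[where g = "\<lambda>((s, n), m). ((- (s div 3), n), m)"])
    have m4: "(- 3 * s) mod 4 = s mod 4" for s :: int
    proof -
      have "- 3 * s = s + 4 * (- s)" by simp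
      then show ?thesis by (simp only: mod_mult_self2)
    qed
    have "(- 3 * s)\<^sup>2 + 12 * n\<^sup>2 + 24 * m\<^sup>2 = 9 * int M \<longleftrightarrow> 3 * s\<^sup>2 + 4 * n\<^sup>2 + 8 * m\<^sup>2 = 3 * int M" for s n m
      unfolding power_mult_distrib by simp linarith
    then have in_iff: "((- 3 * s, n), m) \<in> rep3 1 12 24 (9 * M) \<longleftrightarrow> ((s, n), m) \<in> rep3 3 4 8 (3 * M)" for s n m
      unfolding rep3_def mem_Collect_eq prod.case m4 by (simp only: of_nat_numeral of_nat_1 of_nat_mult mult_1)
    have ex: "\<exists>s n m. p = ((- 3 * s, n), m)" if asm: "p \<in> rep3 1 12 24 (9 * M)" for p
    proof -
      obtain s n m where p: "p = ((s, n), m)" "s\<^sup>2 + 12 * n\<^sup>2 + 24 * m\<^sup>2 = 9 * int M"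
        using asm by (auto simp: rep3_def)
      have "s\<^sup>2 = 3 * (3 * int M - 4 * n\<^sup>2 - 8 * m\<^sup>2)" using p(2) by simp
      then have "s\<^sup>2 mod 3 = 0" by (metis mod_mult_self1_is_0)
      then have "3 dvd s" by (simp add: square_mod_3 split: if_splits)
      then obtain r where "s = 3 * r" by (elim dvdE)
      then have "p = ((- 3 * (- r), n), m)" using p by simp
      then show ?thesis by blast
    qed
    have div: "- (- 3 * s div 3) = s" for s :: int by presburger
    show "(\<lambda>((s, n), m). ((- 3 * s, n), m)) \<in> rep3 3 4 8 (3 * M) \<rightarrow> rep3 1 12 24 (9 * M)"
    proof (rule funcsetI)
      fix p assume "p \<in> rep3 3 4 8 (3 * M)"
      moreover obtain s n m where "p = ((s, n), m)" by (metis surj_pair)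
      ultimately show "(\<lambda>((s, n), m). ((- 3 * s, n), m)) p \<in> rep3 1 12 24 (9 * M)"
        using in_iff by simp
    qed
    show "(\<lambda>((s, n), m). ((- (s div 3), n), m)) \<in> rep3 1 12 24 (9 * M) \<rightarrow> rep3 3 4 8 (3 * M)"
    proof (rule funcsetI)
      fix p assume p: "p \<in> rep3 1 12 24 (9 * M)"
      then obtain s n m where "p = ((- 3 * s, n), m)" using ex by blast
      then show "(\<lambda>((s, n), m). ((- (s div 3), n), m)) p \<in> rep3 3 4 8 (3 * M)"
        using p in_iff[of s n m] div[of s] by simp
    qed
    show "(\<lambda>((s, n), m). ((- (s div 3), n), m)) ((\<lambda>((s, n), m). ((- 3 * s, n), m)) p) = p"
      for p :: "(int \<times> int) \<times> int"
    proof -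
      obtain s n m where "p = ((s, n), m)" by (metis surj_pair)
      then show ?thesis using div[of s] by simp
    qed
    show "(\<lambda>((s, n), m). ((- 3 * s, n), m)) ((\<lambda>((s, n), m). ((- (s div 3), n), m)) p) = p"
      if asm: "p \<in> rep3 1 12 24 (9 * M)" for p
    proof -
      obtain s n m where "p = ((- 3 * s, n), m)" using ex[OF asm] by blast
      then show ?thesis using div[of s] by simp
    qed
  qed
  then show ?thesis by (simp add: bij_betw_same_card)
qed

text \<open>The two relations combine to a recurrence in \<open>k\<close>: consecutive counts add up
  to twice a multiple of 4. It starts with an empty \<open>rep3 1 12 24 u\<close>, because
  \<open>u\<close> is 2 modulo 3.\<close>

lemma eight_dvd_card_rep3:
  assumes "u mod 24 = 17"
  shows "8 dvd card (rep3 3 4 8 (3 * (9 ^ k * u)))"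
proof (induction k)
  have u3: "int u mod 3 = 2" using assms by presburger
  have V: "4 dvd card (rep3 1 4 8 (9 ^ k * u))" for k
  proof (rule card_rep3_1_4_8)
    have "\<exists>c. 9 ^ k = 8 * c + (1 :: nat)"
    proof (induction k)
      case (Suc k)
      then obtain c where "9 ^ k = 8 * c + (1 :: nat)" by blast
      then have "9 ^ Suc k = 8 * (9 * c + 1) + (1 :: nat)" by simp
      then show ?case by blast
    qed simp
    then obtain c where "9 ^ k = 8 * c + (1 :: nat)" by blast
    moreover define d where "d = 3 * (u div 24) + 2"
    then have "u = 8 * d + 1" using assms mult_div_mod_eq[of 24 u] by simp
    ultimately have "9 ^ k * u = 8 * (c * u + d) + 1" by (simp add: algebra_simps)
    then show "(9 ^ k * u) mod 8 = 1" by simp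
    show "t\<^sup>2 \<noteq> int (9 ^ k * u)" for t :: int
      using no_ternary_rep[OF u3, of t 0 0 k] by simp
  qed
  {
    case 0
    have "rep3 1 12 24 u = {}"
    proof -
      have "s\<^sup>2 + 12 * n\<^sup>2 + 24 * m\<^sup>2 \<noteq> int u" for s n m :: int
      proof
        assume "s\<^sup>2 + 12 * n\<^sup>2 + 24 * m\<^sup>2 = int u"
        then have "int u = s\<^sup>2 + 3 * (4 * n\<^sup>2 + 8 * m\<^sup>2)" by simp
        then have "int u mod 3 = s\<^sup>2 mod 3" by (simp only: mod_mult_self2)
        then show False using u3 by (simp add: square_mod_3 split: if_splits)
      qed
      then show ?thesis by (auto simp: rep3_def)
    qed
    then show ?case using V[of 0] card_rep3_mult_3[of u] by (simp; presburger)
  next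
    case (Suc k)
    have "card (rep3 3 4 8 (3 * (9 ^ Suc k * u))) + card (rep3 3 4 8 (3 * (9 ^ k * u)))
        = 2 * card (rep3 1 4 8 (9 ^ Suc k * u))"
      using card_rep3_mult_3[of "9 ^ Suc k * u"] card_rep3_mult_9[of "9 ^ k * u"]
      by (simp add: mult.assoc)
    then show ?case using V[of "Suc k"] Suc by presburger
  }
qed

section \<open>Reduction modulo 32\<close>

definition fps_mod2 :: "int fps \<Rightarrow> bit fps" where
  "fps_mod2 f = Abs_fps (\<lambda>n. of_int (fps_nth f n))"

lemma fps_mod2_nth: "fps_nth (fps_mod2 f) n = of_int (fps_nth f n)"
  by (simp add: fps_mod2_def)

lemma fps_mod2_mult: "fps_mod2 (f * g) = fps_mod2 f * fps_mod2 g"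
  by (rule fps_ext) (simp add: fps_mod2_nth fps_mult_nth)

lemma fps_mod2_theta_ser: "fps_mod2 (theta_ser e I w) = theta_ser e I (\<lambda>i. of_int (w i))"
  by (rule fps_ext) (simp add: fps_mod2_nth theta_ser_nth)

lemma theta_ser_cong:
  "(\<And>i. i \<in> I \<Longrightarrow> w i = w' i) \<Longrightarrow> theta_ser e I w = theta_ser e I w'"
  by (rule fps_ext) (auto simp: theta_ser_nth intro: sum.cong)

text \<open>The exponents of \<open>q\<^sup>2 f\<^sub>1\<^sub>8\<^sup>3\<close> in Jacobi's series, whose coefficients \<open>(-1)\<^sup>n (2 n + 1)\<close> are
  exactly the integers congruent to 1 modulo 4.\<close>
definition cube_exp :: "int \<Rightarrow> nat" where
  "cube_exp s = nat ((9 * s\<^sup>2 - 1) div 4)"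

lemma odd_of_odds: "s \<in> odds \<Longrightarrow> odd s"
  unfolding odds_def mem_Collect_eq by presburger

lemma int_cube_exp:
  assumes "s \<in> odds" shows "4 * int (cube_exp s) + 1 = 9 * s\<^sup>2"
proof -
  obtain a where "s = 2 * a + 1" using odd_of_odds[OF assms] by (elim oddE)
  then have eq: "9 * s\<^sup>2 - 1 = 4 * (9 * (a\<^sup>2 + a) + 2)" by (simp add: power2_eq_square algebra_simps)
  have "a\<^sup>2 + a = a * (a + 1)" by (simp add: power2_eq_square algebra_simps)
  moreover have "0 \<le> a * (a + 1)" by (cases "a \<ge> 0") (auto intro: mult_nonpos_nonpos)
  ultimately have "0 \<le> a\<^sup>2 + a" by simp
  then show ?thesis using eq unfolding cube_exp_def by simp
qed

text \<open>With \<open>s = (-1) ^ n * (2 * n + 1)\<close> the exponent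
  \<open>9 * n * (n + 1) + 2\<close> is \<open>(9 * s ^ 2 - 1) / 4\<close>, and the Jacobi
  coefficient is \<open>s\<close> itself.\<close>

lemma euler_cube_shift: "fps_X\<^sup>2 * euler 18 ^ 3 = theta_ser cube_exp odds (\<lambda>s. s)"
proof -
  have "fps_X\<^sup>2 * euler 18 ^ 3
      = theta_ser (\<lambda>n::nat. 18 * (Suc n choose 2) + 2) UNIV (\<lambda>n. (-1) ^ n * (2 * int n + 1))"
    by (simp add: jacobi_cube theta_ser_shift)
  also have "\<dots> = theta_ser cube_exp odds (\<lambda>s. s)"
  proof (rule theta_ser_reindex)
    show "bij_betw (\<lambda>n. (-1) ^ n * (2 * int n + 1)) UNIV odds"
    proof (rule bij_betwI[where g = "\<lambda>s. nat ((\<bar>s\<bar> - 1) div 2)"])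
      show "(\<lambda>n. (-1) ^ n * (2 * int n + 1)) \<in> UNIV \<rightarrow> odds"
      proof (rule funcsetI)
        fix n :: nat
        show "(-1) ^ n * (2 * int n + 1) \<in> odds"
        proof (cases "even n")
          case True
          then obtain m where "n = 2 * m" by (elim evenE)
          then have "(-1) ^ n * (2 * int n + 1) = 1 + 4 * int m" by simp
          then show ?thesis unfolding odds_def by simp
        next
          case False
          then obtain m where "n = 2 * m + 1" by (elim oddE)
          then have "(-1) ^ n * (2 * int n + 1) = 1 + 4 * (- int m - 1)" by simp
          then show ?thesis unfolding odds_def mem_Collect_eq by (simp only: mod_mult_self2) simp
        qed
      qed
      show "nat ((\<bar>(-1) ^ n * (2 * int n + 1)\<bar> - 1) div 2) = n" for n
        by (simp add: abs_mult)
      show "(-1) ^ nat ((\<bar>s\<bar> - 1) div 2) * (2 * int (nat ((\<bar>s\<bar> - 1) div 2)) + 1) = s" if s: "s \<in> odds" for s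
      proof -
        define j where "j = s div 4"
        have j: "s = 4 * j + 1" using s mult_div_mod_eq[of 4 s] by (simp add: odds_def j_def)
        show ?thesis
        proof (cases "j \<ge> 0")
          case True
          then have "nat ((\<bar>s\<bar> - 1) div 2) = 2 * nat j" using j by simp
          then show ?thesis using True j by simp
        next
          case False
          then have "nat ((\<bar>s\<bar> - 1) div 2) = 2 * nat (- j - 1) + 1" using j by simp
          then show ?thesis using False j by simp
        qed
      qed
    qed simp
    fix n :: nat
    have c: "2 * int (Suc n choose 2) = int n * int n + int n"
      using arg_cong[OF square_eq_choose_2[of n], of int] by (simp add: choose_2_Suc)
    have "((-1) ^ n * (2 * int n + 1))\<^sup>2 = (2 * int n + 1)\<^sup>2"
      by (simp add: power_mult_distrib flip: power_mult)
    also have "\<dots> = 4 * (2 * int (Suc n choose 2)) + 1"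
      unfolding c by (simp add: power2_eq_square algebra_simps)
    finally have "9 * ((-1) ^ n * (2 * int n + 1))\<^sup>2 - 1 = 4 * int (18 * (Suc n choose 2) + 2)"
      by simp
    then show "cube_exp ((-1) ^ n * (2 * int n + 1)) = 18 * (Suc n choose 2) + 2"
      unfolding cube_exp_def by simp
  qed simp
  finally show ?thesis .
qed

lemma finite_fibres_cube_exp: "finite_fibres cube_exp odds"
proof (rule finite_fibres_int[where c = 0])
  fix s assume "s \<in> odds"
  then have "4 * int (cube_exp s) + 1 = 9 * s\<^sup>2" "odd s" by (rule int_cube_exp, rule odd_of_odds)
  moreover have "1 \<le> \<bar>s\<bar>" using \<open>odd s\<close> by (cases "s = 0") auto
  then have "\<bar>s\<bar> * 1 \<le> \<bar>s\<bar> * \<bar>s\<bar>" by (intro mult_left_mono) auto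
  then have "\<bar>s\<bar> \<le> s\<^sup>2" by (simp add: power2_eq_square flip: abs_mult)
  ultimately show "nat \<bar>s\<bar> \<le> cube_exp s + 0" using \<open>1 \<le> \<bar>s\<bar>\<close> by linarith
qed

definition phi_tail :: "int fps" where
  "phi_tail = theta_ser (\<lambda>n. 3 * nat (n\<^sup>2)) {0<..} (\<lambda>n. (-1) ^ nat \<bar>n\<bar>)"

lemma phi_3: "phi 3 = 1 + 2 * phi_tail"
  unfolding phi_def phi_tail_def by (subst theta_ser_even[OF finite_fibres_sqr]) simp_all

lemma finite_fibres_phi_tail: "finite_fibres (\<lambda>n. 3 * nat (n\<^sup>2)) {0<..}"
  by (rule finite_fibres_sqr) simp

lemma fps_mod2_phi_tail: "fps_mod2 phi_tail = sqr_ser 3 {0<..}"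
  unfolding phi_tail_def fps_mod2_theta_ser sqr_ser_def
  by (rule theta_ser_cong) (simp add: minus_one_power_nat_abs)

lemma fps_mod2_cube: "fps_mod2 (theta_ser cube_exp odds (\<lambda>s. s)) = theta_ser cube_exp odds (\<lambda>_. 1)"
  unfolding fps_mod2_theta_ser
proof (rule theta_ser_cong)
  fix s assume "s \<in> odds"
  then show "(of_int s :: bit) = 1"
    using odd_of_odds of_int_bit_eq_0_iff[of s] by (cases "of_int s :: bit") auto
qed

text \<open>Solutions with \<open>n = 0\<close> or \<open>m = 0\<close> are excluded by
  \<open>no_ternary_rep\<close>, where \<open>8 * m ^ 2\<close> is read as
  \<open>4 * m ^ 2 + 4 * m ^ 2\<close>. The others come in fours under sign changes, and their
  number is divisible by 8.\<close>

lemma even_card_rep3_positive: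
  fixes u :: nat
  assumes "u mod 24 = 17"
  shows "even (card {((s, n), m) \<in> rep3 3 4 8 (3 * (9 ^ k * u)). 0 < n \<and> 0 < m})" (is "even (card ?Q)")
proof -
  let ?M = "9 ^ k * u" and ?T = "sqr_ser 3 odds :: int fps" and ?Z = "\<lambda>d. sqr_ser d {0<..} :: int fps"
  have u3: "int u mod 3 = 2" using assms by presburger
  have no: "3 * s\<^sup>2 + 4 * n\<^sup>2 + 4 * m\<^sup>2 \<noteq> 3 * int ?M" for s n m :: int
    using no_ternary_rep[OF u3, of s n m k] by simp
  have T: "fps_nth ?T (3 * ?M) = 0" unfolding sqr_ser_def
  proof (rule theta_ser_nth_eq_0, rule notI)
    fix s assume "3 * nat (s\<^sup>2) = 3 * ?M"
    from arg_cong[OF this, of int] show False using no[of s 0 0] by simp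
  qed
  have T4: "fps_nth (?T * ?Z 4) (3 * ?M) = 0"
  proof (subst sqr_ser_mult, simp, simp, rule theta_ser_nth_eq_0, rule notI)
    fix p :: "int \<times> int" assume "(case p of (i, j) \<Rightarrow> 3 * nat (i\<^sup>2) + 4 * nat (j\<^sup>2)) = 3 * ?M"
    then have "3 * nat ((fst p)\<^sup>2) + 4 * nat ((snd p)\<^sup>2) = 3 * ?M" by (simp add: case_prod_unfold)
    from arg_cong[OF this, of int] show False using no[of "fst p" "snd p" 0] by simp
  qed
  have T8: "fps_nth (?T * ?Z 8) (3 * ?M) = 0"
  proof (subst sqr_ser_mult, simp, simp, rule theta_ser_nth_eq_0, rule notI)
    fix p :: "int \<times> int" assume "(case p of (i, j) \<Rightarrow> 3 * nat (i\<^sup>2) + 8 * nat (j\<^sup>2)) = 3 * ?M"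
    then have "3 * nat ((fst p)\<^sup>2) + 8 * nat ((snd p)\<^sup>2) = 3 * ?M" by (simp add: case_prod_unfold)
    from arg_cong[OF this, of int] show False using no[of "fst p" "snd p" "snd p"] by simp
  qed
  have "?Q = {p \<in> (odds \<times> {0<..}) \<times> {0<..}. (case p of ((h, i), j) \<Rightarrow> 3 * nat (h\<^sup>2) + 4 * nat (i\<^sup>2) + 8 * nat (j\<^sup>2)) = 3 * ?M}"
    by (auto simp: rep3_def odds_def nat_sqr_sum_eq_iff)
  then have Q: "fps_nth (?T * ?Z 4 * ?Z 8) (3 * ?M) = int (card ?Q)"
    by (simp add: sqr_ser_mult3 theta_ser_nth_one case_prod_unfold)
  have "int (card (rep3 3 4 8 (3 * ?M))) = fps_nth (?T * sqr_ser 4 UNIV * sqr_ser 8 UNIV) (3 * ?M)"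
    by (rule card_rep3) simp_all
  also have "?T * sqr_ser 4 UNIV * sqr_ser 8 UNIV
      = ?T + fps_const 2 * (?T * ?Z 4) + fps_const 2 * (?T * ?Z 8) + fps_const 4 * (?T * ?Z 4 * ?Z 8)"
    by (simp add: sqr_ser_UNIV algebra_simps flip: numeral_fps_const)
  also have "fps_nth \<dots> (3 * ?M) = 4 * int (card ?Q)"
    unfolding fps_add_nth fps_mult_left_const_nth T T4 T8 Q by simp
  finally have "card (rep3 3 4 8 (3 * ?M)) = 4 * card ?Q" by linarith
  then obtain d where "4 * card ?Q = 8 * d" using eight_dvd_card_rep3[OF assms, of k] by auto
  then have "card ?Q = 2 * d" by linarith
  then show ?thesis by simp
qed

text \<open>Since \<open>N\<close> is 2 modulo 3, the dissection leaves divisibility by 32 for the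
  coefficient of \<open>K\<close>, the quotient of \<open>J\<close> by \<open>phi 3 ^ 3\<close>.
  Taking an exponent times 4 plus 1 turns each coefficient of \<open>J * S ^ i\<close> into a
  quadratic equation with right side \<open>9 * M\<close>.\<close>

theorem Rbar_star_6_dvd:
  assumes u: "u mod 24 = 17" and N: "4 * N + 1 = 9 * (9 ^ k * u)"
  shows "128 dvd Rbar_star 6 N"
proof -
  define F where "F = Abs_fps (\<lambda>n. int (Rbar_star 6 n))"
  define J where "J = theta_ser cube_exp odds (\<lambda>s. s)"
  define S where "S = phi_tail"
  define M where "M = 9 ^ k * u"
  have u3: "int u mod 3 = 2" using u by presburger
  have no: "3 * s\<^sup>2 + 4 * n\<^sup>2 + 4 * m\<^sup>2 \<noteq> 3 * int M" for s n m :: int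
    using no_ternary_rep[OF u3, of s n m k] by (simp add: M_def)
  have N': "4 * int N + 1 = 9 * int M" using N by (simp add: M_def flip: of_nat_eq_iff[where 'a = int])
  have J0: "fps_nth J N = 0" unfolding J_def
  proof (rule theta_ser_nth_eq_0, rule notI)
    fix s assume "s \<in> odds" "cube_exp s = N"
    then have "9 * s\<^sup>2 = 9 * int M" using int_cube_exp N' by metis
    then show False using no[of s 0 0] by simp
  qed
  have J1: "fps_nth (J * S) N = 0"
    unfolding J_def S_def phi_tail_def theta_ser_mult[OF finite_fibres_cube_exp finite_fibres_phi_tail]
  proof (rule theta_ser_nth_eq_0, rule notI)
    fix p assume "p \<in> odds \<times> {0<..}" and "(case p of (i, j) \<Rightarrow> cube_exp i + 3 * nat (j\<^sup>2)) = N"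
    then obtain s n where "s \<in> odds" "cube_exp s + 3 * nat (n\<^sup>2) = N" by auto
    then have "9 * s\<^sup>2 + 12 * n\<^sup>2 = 9 * int M" using int_cube_exp[of s] N' by auto
    then show False using no[of s n 0] by simp
  qed
  have J2: "fps_nth (J * S * S) N = 0"
    unfolding J_def S_def phi_tail_def theta_ser_mult[OF finite_fibres_cube_exp finite_fibres_phi_tail]
      theta_ser_mult[OF finite_fibres_prod[OF finite_fibres_cube_exp finite_fibres_phi_tail] finite_fibres_phi_tail]
  proof (rule theta_ser_nth_eq_0, rule notI)
    fix p assume "p \<in> (odds \<times> {0<..}) \<times> {0<..}"
      and "(case p of (i, j) \<Rightarrow> (case i of (i, j) \<Rightarrow> cube_exp i + 3 * nat (j\<^sup>2)) + 3 * nat (j\<^sup>2)) = N"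
    then obtain s n m where "s \<in> odds" "cube_exp s + 3 * nat (n\<^sup>2) + 3 * nat (m\<^sup>2) = N" by auto
    then have "9 * s\<^sup>2 + 12 * n\<^sup>2 + 12 * m\<^sup>2 = 9 * int M" using int_cube_exp[of s] N' by auto
    then show False using no[of s n m] by simp
  qed
  let ?t = "theta_ser cube_exp odds (\<lambda>_. 1) :: bit fps"
  have J4: "even (fps_nth (J * S ^ 4) N)"
  proof -
    \<comment> \<open>Modulo 2 the fourth power only multiplies the exponents of \<open>S\<close> by
      4; the resulting \<open>16 * n ^ 2\<close> is \<open>4 * (2 * n) ^ 2\<close>.\<close>
    have "S ^ 4 = (S * S) * (S * S)" by (simp add: power4_eq_xxxx mult.assoc)
    then have "fps_mod2 (J * S ^ 4) = ?t * ((sqr_ser 3 {0<..})\<^sup>2)\<^sup>2"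
      by (simp add: fps_mod2_mult J_def S_def fps_mod2_cube fps_mod2_phi_tail power2_eq_square)
    also have "\<dots> = ?t * sqr_ser 12 {0<..}" by (simp add: sqr_ser_square)
    also have "\<dots> = theta_ser (\<lambda>(i, j). cube_exp i + 12 * nat (j\<^sup>2)) (odds \<times> {0<..}) (\<lambda>(i, j). 1 * 1)"
      unfolding sqr_ser_def by (rule theta_ser_mult[OF finite_fibres_cube_exp finite_fibres_sqr]) simp
    also have "fps_nth \<dots> N = 0"
    proof (rule theta_ser_nth_eq_0, rule notI)
      fix p assume "p \<in> odds \<times> {0<..}" and "(case p of (i, j) \<Rightarrow> cube_exp i + 12 * nat (j\<^sup>2)) = N"
      then obtain s n where "s \<in> odds" "cube_exp s + 12 * nat (n\<^sup>2) = N" by auto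
      then have "9 * s\<^sup>2 + 48 * n\<^sup>2 = 9 * int M" using int_cube_exp[of s] N' by auto
      then show False using no[of s "2 * n" 0] by (simp add: power_mult_distrib)
    qed
    finally show ?thesis by (simp add: fps_mod2_nth of_int_bit_eq_0_iff)
  qed
  have J3: "even (fps_nth (J * S ^ 3) N)"
  proof -
    \<comment> \<open>Modulo 2 the square inside the cube doubles exponents, which produces the
      coefficients 3 and 6, that is 4 and 8 after rescaling.\<close>
    have "S ^ 3 = S * (S * S)" by (simp add: power3_eq_cube mult.assoc)
    then have "fps_mod2 (J * S ^ 3) = ?t * (sqr_ser 3 {0<..} * (sqr_ser 3 {0<..})\<^sup>2)"
      by (simp add: fps_mod2_mult J_def S_def fps_mod2_cube fps_mod2_phi_tail power2_eq_square)
    also have "\<dots> = ?t * sqr_ser 3 {0<..} * sqr_ser 6 {0<..}" by (simp add: sqr_ser_square mult.assoc)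
    also have "\<dots> = theta_ser (\<lambda>(p, j). (case p of (h, i) \<Rightarrow> cube_exp h + 3 * nat (i\<^sup>2)) + 6 * nat (j\<^sup>2))
        ((odds \<times> {0<..}) \<times> {0<..}) (\<lambda>(p, j). (case p of (h, i) \<Rightarrow> 1 * 1) * 1)"
      unfolding sqr_ser_def theta_ser_mult[OF finite_fibres_cube_exp finite_fibres_phi_tail]
      by (rule theta_ser_mult[OF finite_fibres_prod[OF finite_fibres_cube_exp finite_fibres_phi_tail] finite_fibres_sqr]) simp
    also have "\<dots> = theta_ser (\<lambda>(p, j). (case p of (h, i) \<Rightarrow> cube_exp h + 3 * nat (i\<^sup>2)) + 6 * nat (j\<^sup>2))
        ((odds \<times> {0<..}) \<times> {0<..}) (\<lambda>_. 1)"
      by (rule theta_ser_cong) auto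
    finally have nth: "fps_nth (fps_mod2 (J * S ^ 3)) N = of_nat (card {x \<in> (odds \<times> {0<..}) \<times> {0<..}.
        (case x of (p, j) \<Rightarrow> (case p of (h, i) \<Rightarrow> cube_exp h + 3 * nat (i\<^sup>2)) + 6 * nat (j\<^sup>2)) = N})"
      by (simp only: theta_ser_nth_one)
    have "cube_exp s + 3 * nat (n\<^sup>2) + 6 * nat (m\<^sup>2) = N \<longleftrightarrow> 3 * s\<^sup>2 + 4 * n\<^sup>2 + 8 * m\<^sup>2 = 3 * int M"
      if "s \<in> odds" for s n m
    proof -
      have "cube_exp s + 3 * nat (n\<^sup>2) + 6 * nat (m\<^sup>2) = N \<longleftrightarrow> int (cube_exp s) + 3 * n\<^sup>2 + 6 * m\<^sup>2 = int N"
        by (simp flip: of_nat_eq_iff[where 'a = int])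
      then show ?thesis using int_cube_exp[OF that] N' by linarith
    qed
    then have "{x \<in> (odds \<times> {0<..}) \<times> {0<..}.
        (case x of (p, j) \<Rightarrow> (case p of (h, i) \<Rightarrow> cube_exp h + 3 * nat (i\<^sup>2)) + 6 * nat (j\<^sup>2)) = N}
      = {((s, n), m) \<in> rep3 3 4 8 (3 * (9 ^ k * u)). 0 < n \<and> 0 < m}"
      by (auto simp: rep3_def M_def odds_def)
    then have "fps_nth (fps_mod2 (J * S ^ 3)) N = 0"
      using even_card_rep3_positive[OF u, of k] unfolding nth of_nat_bit_eq_0_iff by simp
    then show ?thesis by (simp add: fps_mod2_nth of_int_bit_eq_0_iff)
  qed
  \<comment> \<open>\<open>U\<close> is the binomial series of \<open>(1 + 2 S)\<^bsup>-3\<^esup>\<close> with coefficients reduced modulo 32.\<close>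
  define U where "U = 1 - fps_const 6 * S - fps_const 8 * (S * S) + fps_const 16 * (S ^ 3 + S ^ 4)"
  define R where "R = - (S ^ 2) - 3 * S ^ 3 - S ^ 4 + 7 * S ^ 5 + 10 * S ^ 6 + 4 * S ^ 7"
  have U: "(1 + 2 * S) ^ 3 * U = 1 + fps_const 32 * R"
    unfolding U_def R_def numeral_fps_const[symmetric] by algebra
  have "fps_nth phi_tail 0 = 0"
    unfolding phi_tail_def by (rule theta_ser_nth_eq_0) auto
  then have "fps_nth (phi 3) 0 = 1"
    unfolding phi_3 by (simp add: numeral_fps_const)
  \<comment> \<open>The constant coefficient 1 is a unit, so \<open>phi 3\<close> is invertible over
    the integers.\<close>
  then obtain V where V: "phi 3 * V = 1"
    using fps_right_inverse[of "phi 3" 1] by auto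
  define K where "K = J * V ^ 3"
  have "K * phi 3 ^ 3 = J * (phi 3 * V) ^ 3" by (simp only: K_def power_mult_distrib mult_ac)
  then have K: "K * phi 3 ^ 3 = J" by (simp add: V)
  have "F * (euler 1)\<^sup>2 = euler 2 * euler 6" unfolding F_def by (rule Rbar_star_gf) simp
  then have "sect 2 F * phi 3 ^ 3 = fps_const 4 * J"
    using sect_2_dissection euler_cube_shift by (simp add: J_def mult.assoc numeral_fps_const)
  then have "sect 2 F * (phi 3 * V) ^ 3 = fps_const 4 * K"
    unfolding K_def power_mult_distrib mult.assoc[symmetric] by simp
  then have F2: "sect 2 F = fps_const 4 * K" by (simp add: V)
  have "J * U = K + fps_const 32 * (K * R)"
    unfolding K[symmetric] phi_3 S_def[symmetric] mult.assoc U by (simp add: algebra_simps)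
  then have "fps_nth K N + 32 * fps_nth (K * R) N = fps_nth (J * U) N" by simp
  also have "J * U = J - fps_const 6 * (J * S) - fps_const 8 * (J * S * S)
      + fps_const 16 * (J * S ^ 3 + J * S ^ 4)"
    unfolding U_def by (simp only: algebra_simps mult_1_left)
  also have "fps_nth \<dots> N = 16 * (fps_nth (J * S ^ 3) N + fps_nth (J * S ^ 4) N)"
    by (simp add: J0 J1 J2)
  \<comment> \<open>A factor 16 times a sum of two even coefficients.\<close>
  finally have "32 dvd fps_nth K N" using J3 J4 by (auto elim!: evenE) presburger
  moreover have "N mod 3 = 2" using N by presburger
  then have "int (Rbar_star 6 N) = 4 * fps_nth K N"
    using arg_cong[OF F2, of "\<lambda>f. fps_nth f N"] by (simp add: sect_nth F_def)
  ultimately have "128 dvd int (Rbar_star 6 N)" by presburger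
  then show ?thesis by presburger
qed

theorem theorem1p1:
  fixes n k :: nat
  shows "(128::nat) dvd Rbar_star 6 (18 * 3 ^ (2 * k + 1) * n + (153 * 3 ^ (2 * k) - 1) div 4)"
proof (rule Rbar_star_6_dvd)
  show "(24 * n + 17) mod 24 = 17" by simp
  \<comment> \<open>As \<open>9 ^ k\<close> is 1 modulo 4, so is \<open>153 * 9 ^ k\<close>; the
    natural-number subtraction and division in the argument are therefore exact.\<close>
  have "\<exists>c. 9 ^ k = 4 * c + (1 :: nat)"
  proof (induction k)
    case (Suc k)
    then obtain c where "9 ^ k = 4 * c + (1 :: nat)" by blast
    then have "9 ^ Suc k = 4 * (9 * c + 2) + (1 :: nat)" by simp
    then show ?case by blast
  qed simp
  then obtain c where c: "9 ^ k = 4 * c + (1 :: nat)" by blast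
  have p: "3 ^ (2 * k) = (9 ^ k :: nat)" by (simp add: power_mult)
  have "(153 * 3 ^ (2 * k) - 1) div 4 = 153 * c + 38"
    unfolding p c by simp
  moreover have "18 * 3 ^ (2 * k + 1) * n = 54 * (4 * c + 1) * n"
    unfolding power_add p c by simp
  ultimately show "4 * (18 * 3 ^ (2 * k + 1) * n + (153 * 3 ^ (2 * k) - 1) div 4) + 1
      = 9 * (9 ^ k * (24 * n + 17))"
    unfolding c by (simp add: algebra_simps)
qed

end
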